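(* The category $\mathrm{Mod}_R$ is locally noetherian: every submodule of a finitely generated $R$-module is finitely generated.
   Context: $k$ is algebraically closed of characteristic $p>0$; $\mathrm{GL}=\bigcup_n\mathrm{GL}_n(k)$, $\mathbf V=\bigcup_n k^n$; $R=\bigwedge(\mathbf V)$ is the exterior algebra. $\mathrm{Mod}_R$ is the category of graded $R$-modules with compatible $\mathrm{GL}$-action ($g(rm)=g(r)g(m)$) which are polynomial representations (subquotients of direct sums of tensor powers of $\mathbf V$). Submodules are $\mathrm{GL}$-stable $R$-submodules. Finitely generated means a quotient of $R\otimes W$ with $W$ a finite-length polynomial representation. *)

theory Defs
  imports "HOL-Computational_Algebra.Polynomial" "HOL-Combinatorics.Permutations"
begin

definition alg_closed_field :: "'k::field itself \<Rightarrow> bool" where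
  "alg_closed_field _ \<longleftrightarrow> (\<forall>q :: 'k poly. degree q > 0 \<longrightarrow> (\<exists>x. poly q x = 0))"

section \<open>The group GL = union of GL_n(k), as infinite matrices nat x nat\<close>

definition fin_supp :: "('a \<Rightarrow> 'b::zero) \<Rightarrow> bool" where
  "fin_supp f \<longleftrightarrow> finite {x. f x \<noteq> 0}"

definition idm :: "nat \<Rightarrow> nat \<Rightarrow> 'k::field" where
  "idm i j = (if i = j then 1 else 0)"

definition eventually_id :: "(nat \<Rightarrow> nat \<Rightarrow> 'k::field) \<Rightarrow> bool" where
  "eventually_id g \<longleftrightarrow> (\<exists>n. \<forall>i j. (n \<le> i \<or> n \<le> j) \<longrightarrow> g i j = idm i j)"

definition mat_mul :: "(nat \<Rightarrow> nat \<Rightarrow> 'k::field) \<Rightarrow> (nat \<Rightarrow> nat \<Rightarrow> 'k) \<Rightarrow> nat \<Rightarrow> nat \<Rightarrow> 'k" where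
  "mat_mul g h i j = (\<Sum>l\<in>{l. g i l \<noteq> 0}. g i l * h l j)"

definition GL :: "(nat \<Rightarrow> nat \<Rightarrow> 'k::field) set" where
  "GL = {g. eventually_id g \<and>
            (\<exists>h. eventually_id h \<and> mat_mul g h = idm \<and> mat_mul h g = idm)}"

text \<open>An element of the direct sum over i :: nat of V^{tensor dg i} is a finitely supported
  function on pairs (i, w), w a word of length dg i (the basis vector e_{w_1} x ... x e_{w_d}
  of the i-th summand).\<close>

definition TS :: "(nat \<Rightarrow> nat) \<Rightarrow> (nat \<times> nat list \<Rightarrow> 'k::field) set" where
  "TS dg = {x. fin_supp x \<and> (\<forall>i w. x (i, w) \<noteq> 0 \<longrightarrow> length w = dg i)}"

definition tact :: "(nat \<Rightarrow> nat \<Rightarrow> 'k::field) \<Rightarrow> (nat \<times> nat list \<Rightarrow> 'k) \<Rightarrow> nat \<times> nat list \<Rightarrow> 'k" where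
  "tact g x = (\<lambda>(i, w). \<Sum>v\<in>{v. x (i, v) \<noteq> 0 \<and> length v = length w}.
                          (\<Prod>m<length w. g (w ! m) (v ! m)) * x (i, v))"

text \<open>An element of R is a finitely supported function on finite subsets S of nat;
  S stands for e_{s_1} \<and> ... \<and> e_{s_k} with s_1 < ... < s_k.\<close>

definition Rel :: "(nat set \<Rightarrow> 'k::field) set" where
  "Rel = {r. fin_supp r \<and> (\<forall>S. r S \<noteq> 0 \<longrightarrow> finite S)}"

definition wsign :: "nat set \<Rightarrow> nat set \<Rightarrow> 'k::field" where
  "wsign S T = (-1) ^ card {(a, b). a \<in> S \<and> b \<in> T \<and> b < a}"

definition Rmul :: "(nat set \<Rightarrow> 'k::field) \<Rightarrow> (nat set \<Rightarrow> 'k) \<Rightarrow> nat set \<Rightarrow> 'k" where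
  "Rmul r s U = (\<Sum>(S, T)\<in>{(S, T). r S \<noteq> 0 \<and> s T \<noteq> 0 \<and> S \<inter> T = {} \<and> S \<union> T = U}.
                    wsign S T * r S * s T)"

definition Rbasis :: "nat set \<Rightarrow> nat set \<Rightarrow> 'k::field" where
  "Rbasis S = (\<lambda>T. if T = S then 1 else 0)"

definition Rscal :: "'k::field \<Rightarrow> nat set \<Rightarrow> 'k" where
  "Rscal c = (\<lambda>T. if T = {} then c else 0)"

definition minor_det :: "(nat \<Rightarrow> nat \<Rightarrow> 'k::field) \<Rightarrow> nat set \<Rightarrow> nat set \<Rightarrow> 'k" where
  "minor_det g T S = (\<Sum>p\<in>{p. p permutes {..<card S}}.
      of_int (sign p) * (\<Prod>m<card S. g (sorted_list_of_set T ! p m) (sorted_list_of_set S ! m)))"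

text \<open>GL acts on R by algebra automorphisms: g(e_S) = sum over T of det(g_{T,S}) e_T.\<close>
definition ract :: "(nat \<Rightarrow> nat \<Rightarrow> 'k::field) \<Rightarrow> (nat set \<Rightarrow> 'k) \<Rightarrow> nat set \<Rightarrow> 'k" where
  "ract g r T = (if finite T then
      (\<Sum>S\<in>{S. r S \<noteq> 0 \<and> card S = card T}. minor_det g T S * r S) else 0)"

text \<open>A module lives on a carrier M inside a type 'm (an abelian group); it comes with a
  GL-action act, an R-action rmul (the k-linear structure is the action of k \<subseteq> R) and
  a grading gr (homogeneous components, indexed by integers).\<close>

definition ksub :: "((nat set \<Rightarrow> 'k::field) \<Rightarrow> 'm::ab_group_add \<Rightarrow> 'm) \<Rightarrow> 'm set \<Rightarrow> bool" where
  "ksub rmul U \<longleftrightarrow> 0 \<in> U \<and> (\<forall>x\<in>U. \<forall>y\<in>U. x + y \<in> U) \<and> (\<forall>c. \<forall>x\<in>U. rmul (Rscal c) x \<in> U)"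

definition gl_sub :: "((nat \<Rightarrow> nat \<Rightarrow> 'k::field) \<Rightarrow> 'm \<Rightarrow> 'm) \<Rightarrow> ((nat set \<Rightarrow> 'k) \<Rightarrow> 'm::ab_group_add \<Rightarrow> 'm)
    \<Rightarrow> 'm set \<Rightarrow> bool" where
  "gl_sub act rmul U \<longleftrightarrow> ksub rmul U \<and> (\<forall>g\<in>GL. \<forall>x\<in>U. act g x \<in> U)"

text \<open>Polynomial representation: U is (equivariantly isomorphic to) a subquotient of a direct
  sum of tensor powers of V, i.e. there is a GL-stable subspace N1 of such a direct sum and a
  GL-equivariant k-linear surjection N1 \<rightarrow> U (its kernel is then the GL-stable N2).\<close>
definition poly_rep :: "((nat \<Rightarrow> nat \<Rightarrow> 'k::field) \<Rightarrow> 'm \<Rightarrow> 'm) \<Rightarrow> ((nat set \<Rightarrow> 'k) \<Rightarrow> 'm::ab_group_add \<Rightarrow> 'm)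
    \<Rightarrow> 'm set \<Rightarrow> bool" where
  "poly_rep act rmul U \<longleftrightarrow>
    (\<exists>(dg :: nat \<Rightarrow> nat) (N1 :: (nat \<times> nat list \<Rightarrow> 'k) set) \<phi>.
       N1 \<subseteq> TS dg \<and> (\<lambda>z. 0) \<in> N1 \<and> (\<forall>x\<in>N1. \<forall>y\<in>N1. (\<lambda>z. x z + y z) \<in> N1) \<and> (\<forall>c. \<forall>x\<in>N1. (\<lambda>z. c * x z) \<in> N1) \<and>
       (\<forall>g\<in>GL. \<forall>x\<in>N1. tact g x \<in> N1) \<and>
       \<phi> ` N1 = U \<and>
       (\<forall>x\<in>N1. \<forall>y\<in>N1. \<phi> (\<lambda>z. x z + y z) = \<phi> x + \<phi> y) \<and>
       (\<forall>c. \<forall>x\<in>N1. \<phi> (\<lambda>z. c * x z) = rmul (Rscal c) (\<phi> x)) \<and>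
       (\<forall>g\<in>GL. \<forall>x\<in>N1. \<phi> (tact g x) = act g (\<phi> x)))"

definition homog_decomp :: "(int \<Rightarrow> 'm::ab_group_add set) \<Rightarrow> 'm \<Rightarrow> (int \<Rightarrow> 'm) \<Rightarrow> bool" where
  "homog_decomp gr x c \<longleftrightarrow> finite {n. c n \<noteq> 0} \<and> (\<forall>n. c n \<in> gr n) \<and> x = sum c {n. c n \<noteq> 0}"

definition is_Rmod :: "((nat \<Rightarrow> nat \<Rightarrow> 'k::field) \<Rightarrow> 'm \<Rightarrow> 'm) \<Rightarrow> ((nat set \<Rightarrow> 'k) \<Rightarrow> 'm::ab_group_add \<Rightarrow> 'm)
    \<Rightarrow> (int \<Rightarrow> 'm set) \<Rightarrow> 'm set \<Rightarrow> bool" where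
  "is_Rmod act rmul gr M \<longleftrightarrow>
     \<comment> \<open>R-module\<close>
     0 \<in> M \<and> (\<forall>x\<in>M. \<forall>y\<in>M. x + y \<in> M) \<and>
     (\<forall>r\<in>Rel. \<forall>x\<in>M. rmul r x \<in> M) \<and>
     (\<forall>r\<in>Rel. \<forall>s\<in>Rel. \<forall>x\<in>M. rmul (\<lambda>S. r S + s S) x = rmul r x + rmul s x) \<and>
     (\<forall>r\<in>Rel. \<forall>x\<in>M. \<forall>y\<in>M. rmul r (x + y) = rmul r x + rmul r y) \<and>
     (\<forall>r\<in>Rel. \<forall>s\<in>Rel. \<forall>x\<in>M. rmul (Rmul r s) x = rmul r (rmul s x)) \<and>
     (\<forall>x\<in>M. rmul (Rbasis {}) x = x) \<and>
     \<comment> \<open>GL-action, linear and compatible: g(rm) = g(r)g(m)\<close>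
     (\<forall>g\<in>GL. \<forall>x\<in>M. act g x \<in> M) \<and>
     (\<forall>x\<in>M. act idm x = x) \<and>
     (\<forall>g\<in>GL. \<forall>h\<in>GL. \<forall>x\<in>M. act (mat_mul g h) x = act g (act h x)) \<and>
     (\<forall>g\<in>GL. \<forall>x\<in>M. \<forall>y\<in>M. act g (x + y) = act g x + act g y) \<and>
     (\<forall>g\<in>GL. \<forall>r\<in>Rel. \<forall>x\<in>M. act g (rmul r x) = rmul (ract g r) (act g x)) \<and>
     \<comment> \<open>grading: M = direct sum of GL-stable subspaces gr n, R_a gr n \<subseteq> gr (n + a)\<close>
     (\<forall>n. gr n \<subseteq> M \<and> gl_sub act rmul (gr n)) \<and>
     (\<forall>S n x. finite S \<longrightarrow> x \<in> gr n \<longrightarrow> rmul (Rbasis S) x \<in> gr (n + int (card S))) \<and>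
     (\<forall>x\<in>M. \<exists>!c. homog_decomp gr x c) \<and>
     \<comment> \<open>polynomial representation\<close>
     poly_rep act rmul M"

definition finite_length :: "((nat \<Rightarrow> nat \<Rightarrow> 'k::field) \<Rightarrow> 'm \<Rightarrow> 'm) \<Rightarrow> ((nat set \<Rightarrow> 'k) \<Rightarrow> 'm::ab_group_add \<Rightarrow> 'm)
    \<Rightarrow> 'm set \<Rightarrow> bool" where
  "finite_length act rmul U \<longleftrightarrow>
    (\<exists>Us :: 'm set list. Us \<noteq> [] \<and> hd Us = {0} \<and> last Us = U \<and>
       (\<forall>i<length Us. gl_sub act rmul (Us ! i)) \<and>
       (\<forall>i. Suc i < length Us \<longrightarrow> Us ! i \<subset> Us ! Suc i \<and>
          (\<forall>W. gl_sub act rmul W \<longrightarrow> Us ! i \<subseteq> W \<longrightarrow> W \<subseteq> Us ! Suc i \<longrightarrow>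
               W = Us ! i \<or> W = Us ! Suc i)))"

text \<open>Finitely generated: M is a quotient of R \<otimes> W with W a finite-length polynomial
  representation (graded). Equivalently (image of such a map of graded R-modules): M is
  generated as an R-module by a graded GL-stable subspace U which is a finite-length
  polynomial representation (U = image of W).\<close>
definition fin_gen :: "((nat \<Rightarrow> nat \<Rightarrow> 'k::field) \<Rightarrow> 'm \<Rightarrow> 'm) \<Rightarrow> ((nat set \<Rightarrow> 'k) \<Rightarrow> 'm::ab_group_add \<Rightarrow> 'm)
    \<Rightarrow> (int \<Rightarrow> 'm set) \<Rightarrow> 'm set \<Rightarrow> bool" where
  "fin_gen act rmul gr M \<longleftrightarrow>
    (\<exists>U. U \<subseteq> M \<and> gl_sub act rmul U \<and>
       (\<forall>x\<in>U. \<forall>c. homog_decomp gr x c \<longrightarrow> (\<forall>n. c n \<in> U)) \<and>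
       finite_length act rmul U \<and> poly_rep act rmul U \<and>
       M = \<Inter>{N. U \<subseteq> N \<and> 0 \<in> N \<and> (\<forall>x\<in>N. \<forall>y\<in>N. x + y \<in> N) \<and>
                  (\<forall>r\<in>Rel. \<forall>x\<in>N. rmul r x \<in> N)})"

end

(*
  A finitely generated M is a quotient of R \<otimes> N1 with N1 inside a finite direct sum of tensor
  powers of V. A Groebner argument that uses only permutation matrices and multiplication by the
  monomials e_T shows that R \<otimes> N1 is noetherian: the monomials e_S \<otimes> e_w are totally
  ordered compatibly with increasing maps of indices and with unions S \<mapsto> T \<union> S, the leading
  monomials of a stable submodule are closed under both operations, and by Higman's lemma such an
  upward closed set has a finite basis; a submodule is determined by its leading monomials. Hence N
  is generated over R by the GL-span U of finitely many homogeneous elements.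

  That U has finite length is seen through its presentation by a GL-stable subspace W of finitely
  many tensor powers V^{\<otimes>d_i} with all d_i \<le> D. As k is infinite, diagonal matrices split
  W according to the letters of words, and a word has at most D distinct letters; so, up to
  permutations, W is determined by its finite-dimensional part on words with letters below D.
*)

theory Submission
  imports Defs "HOL-Library.Sublist" "HOL-Library.Nat_Bijection" "HOL-Library.Infinite_Set"
begin

section \<open>Subspaces of functions and leading positions\<close>

text \<open>In positive characteristic polynomial representations need not be semisimple, so leading
  terms replace any decomposition into irreducibles. Two things could spoil a leading monomial.
  Multiplication by e_T kills every e_S with S meeting T; hence T is always taken disjoint from the
  set of the leading monomial, and it does no harm if other terms vanish. A permutation may disturb
  the order of the terms and create signs; hence it has to be increasing on all indices that the
  element involves. An increasing map of \<open>nat\<close> is usually no element of GL, but on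
  finitely many indices it agrees with a permutation of finite support. Higman's lemma needs a
  finite alphabet, hence finitely many tensor powers. Finite length of the generating representation
  supplies them: it is generated under GL by finitely many elements, and each of these lifts to an
  element that meets finitely many summands. The same reduction is applied to the space U inside N,
  this time with a tensor presentation of N itself; the bound D comes from there.\<close>

definition fun_subspace :: "('b \<Rightarrow> 'k::field) set \<Rightarrow> bool" where
  "fun_subspace W \<longleftrightarrow> (\<lambda>z. 0) \<in> W \<and> (\<forall>x\<in>W. \<forall>y\<in>W. (\<lambda>z. x z + y z) \<in> W) \<and>
     (\<forall>c. \<forall>x\<in>W. (\<lambda>z. c * x z) \<in> W)"

lemma fun_subspaceD:
  assumes "fun_subspace W"
  shows "(\<lambda>z. 0) \<in> W"
    and "x \<in> W \<Longrightarrow> y \<in> W \<Longrightarrow> (\<lambda>z. x z + y z) \<in> W"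
    and "x \<in> W \<Longrightarrow> (\<lambda>z. c * x z) \<in> W"
  using assms unfolding fun_subspace_def by simp_all

definition is_lead :: "('b \<times> 'b) set \<Rightarrow> ('b \<Rightarrow> 'k::zero) \<Rightarrow> 'b \<Rightarrow> bool" where
  "is_lead r x m \<longleftrightarrow> x m \<noteq> 0 \<and> (\<forall>m'. x m' \<noteq> 0 \<longrightarrow> m' = m \<or> (m', m) \<in> r)"

definition leads :: "('b \<times> 'b) set \<Rightarrow> ('b \<Rightarrow> 'k::zero) set \<Rightarrow> 'b set" where
  "leads r W = {m. \<exists>x\<in>W. is_lead r x m}"

lemma ex_maximal_total:
  assumes "finite A" "A \<noteq> {}" "A \<subseteq> B" "total_on B r" "trans r"
  shows "\<exists>m\<in>A. \<forall>a\<in>A. a = m \<or> (a, m) \<in> r"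
  using assms
proof (induction A rule: finite_ne_induct)
  case (singleton x)
  then show ?case by simp
next
  case (insert x F)
  then obtain m where m: "m \<in> F" "\<forall>a\<in>F. a = m \<or> (a, m) \<in> r" by blast
  have "x \<in> B" "m \<in> B" using insert m by auto
  then consider "(x, m) \<in> r" | "(m, x) \<in> r" | "x = m"
    using insert.prems(2) by (meson total_on_def)
  then show ?case
  proof cases
    case 2
    then have "\<forall>a\<in>insert x F. a = x \<or> (a, x) \<in> r"
      using m(2) transD[OF insert.prems(3) _ 2] 2 by auto
    then show ?thesis by blast
  qed (use m in blast)+
qed

lemma ex_lead:
  assumes "fin_supp x" "\<And>z. x z \<noteq> 0 \<Longrightarrow> z \<in> B" "total_on B r" "trans r" "x \<noteq> (\<lambda>z. 0)"
  shows "\<exists>m. is_lead r x m"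
proof -
  have "\<exists>m\<in>{z. x z \<noteq> 0}. \<forall>a\<in>{z. x z \<noteq> 0}. a = m \<or> (a, m) \<in> r"
    by (rule ex_maximal_total) (use assms in \<open>auto simp: fin_supp_def fun_eq_iff\<close>)
  then show ?thesis unfolding is_lead_def by auto
qed

text \<open>Gaussian elimination: an element of \<open>W'\<close> shares its leading position with
  some \<open>y\<close> in \<open>W\<close>, and subtracting a multiple of \<open>y\<close> moves
  the lead strictly down, so well-founded induction applies. Totality is asked on \<open>B\<close>
  only, because the order on monomials is total only where the sets are finite.\<close>

lemma subspace_eqI_leads:
  assumes W: "fun_subspace W" and W': "fun_subspace W'" and sub: "W \<subseteq> W'"
    and supp: "\<And>x. x \<in> W' \<Longrightarrow> fin_supp x" "\<And>x z. x \<in> W' \<Longrightarrow> x z \<noteq> 0 \<Longrightarrow> z \<in> B"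
    and r: "wf r" "trans r" "total_on B r"
    and le: "leads r W' \<subseteq> leads r W"
  shows "W = W'"
proof -
  have *: "\<forall>x\<in>W'. is_lead r x m \<longrightarrow> x \<in> W" for m
    using r(1)
  proof (induction m rule: wf_induct_rule)
    case (less m)
    show ?case
    proof (intro ballI impI)
      fix x assume x: "x \<in> W'" "is_lead r x m"
      then have "m \<in> leads r W" using le by (auto simp: leads_def)
      then obtain y where y: "y \<in> W" "is_lead r y m" by (auto simp: leads_def)
      define c where "c = x m / y m"
      define d where "d = (\<lambda>z. x z + (- c) * y z)"
      have "(\<lambda>z. (- c) * y z) \<in> W'" using y sub by (intro fun_subspaceD[OF W']) auto
      then have d: "d \<in> W'" unfolding d_def by (intro fun_subspaceD(2)[OF W' x(1)])
      have dm: "d m = 0" using y by (simp add: d_def c_def is_lead_def)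
      have "d \<in> W"
      proof (cases "d = (\<lambda>z. 0)")
        case True
        then show ?thesis using W by (simp add: fun_subspace_def)
      next
        case False
        then obtain m' where m': "is_lead r d m'"
          using ex_lead[of d B r] supp d r by blast
        then have "x m' \<noteq> 0 \<or> y m' \<noteq> 0" "m' \<noteq> m"
          using dm by (auto simp: is_lead_def d_def)
        then have "(m', m) \<in> r" using x(2) y(2) by (auto simp: is_lead_def)
        then show ?thesis using less.IH d m' by blast
      qed
      moreover have "(\<lambda>z. c * y z) \<in> W" using y by (intro fun_subspaceD[OF W])
      ultimately have "(\<lambda>z. d z + c * y z) \<in> W" by (intro fun_subspaceD(2)[OF W])
      then show "x \<in> W" by (simp add: d_def)
    qed
  qed
  have "x \<in> W" if "x \<in> W'" for x
  proof (cases "x = (\<lambda>z. 0)")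
    case True
    then show ?thesis using W by (simp add: fun_subspace_def)
  next
    case False
    then show ?thesis using ex_lead[of x B r] supp that r * by blast
  qed
  then show ?thesis using sub by blast
qed

section \<open>Higman's lemma and the order on monomials\<close>

definition bad_seq :: "'a set \<Rightarrow> (nat \<Rightarrow> 'a list) \<Rightarrow> bool" where
  "bad_seq A f \<longleftrightarrow> (\<forall>n. f n \<in> lists A) \<and> (\<forall>i j. i < j \<longrightarrow> \<not> subseq (f i) (f j))"

text \<open>The minimal bad sequence of Nash-Williams: entries are fixed one after another, each as
  short as any bad continuation allows.\<close>

lemma ex_minimal_bad_seq:
  assumes "bad_seq A f"
  shows "\<exists>g. bad_seq A g \<and>
    (\<forall>n h. bad_seq A h \<longrightarrow> (\<forall>j<n. h j = g j) \<longrightarrow> length (g n) \<le> length (h n))"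
proof -
  \<comment> \<open>In \<open>P n h\<close> the entries before \<open>n\<close> are already minimal;
    the later ones are still free.\<close>
  define P where "P n h \<longleftrightarrow> bad_seq A h \<and>
    (\<forall>i<n. \<forall>h'. bad_seq A h' \<longrightarrow> (\<forall>j<i. h' j = h j) \<longrightarrow> length (h i) \<le> length (h' i))" for n h
  have "\<exists>H. \<forall>n. P n (H n) \<and> (\<forall>j<n. H (Suc n) j = H n j)"
  proof (rule dependent_nat_choice)
    show "\<exists>h. P 0 h" using assms by (auto simp: P_def)
    fix h n assume h: "P n h"
    let ?Q = "\<lambda>h'. bad_seq A h' \<and> (\<forall>j<n. h' j = h j)"
    have "?Q h" using h by (simp add: P_def)
    then obtain h' where h': "?Q h'" "\<And>h''. ?Q h'' \<Longrightarrow> length (h' n) \<le> length (h'' n)"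
      using ex_has_least_nat[of ?Q h "\<lambda>h. length (h n)"] by blast
    have "P (Suc n) h'"
      unfolding P_def
    proof (intro conjI allI impI)
      fix i h'' assume i: "i < Suc n" and b: "bad_seq A h''" and e: "\<forall>j<i. h'' j = h' j"
      show "length (h' i) \<le> length (h'' i)"
      proof (cases "i = n")
        case True
        then show ?thesis using h' b e by auto
      next
        case False
        then have "i < n" using i by simp
        moreover from this have "\<forall>j<i. h'' j = h j" using e h'(1) by auto
        ultimately show ?thesis using h b h'(1) by (simp add: P_def)
      qed
    qed (use h' in auto)
    then show "\<exists>h'. P (Suc n) h' \<and> (\<forall>j<n. h' j = h j)" using h' by blast
  qed
  then obtain H where H: "\<And>n. P n (H n)" "\<And>n j. j < n \<Longrightarrow> H (Suc n) j = H n j" by blast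
  \<comment> \<open>Entry \<open>j\<close> never changes after stage \<open>Suc j\<close>, so the
    diagonal of the stages agrees with each stage on its fixed entries.\<close>
  have agree: "H n j = H (Suc j) j" if "j < n" for n j
    using that by (induction n) (auto simp: less_Suc_eq H(2))
  define g where "g n = H (Suc n) n" for n
  have "bad_seq A g"
    unfolding bad_seq_def
  proof (intro conjI allI impI)
    show "g n \<in> lists A" for n using H(1)[of "Suc n"] by (simp add: P_def bad_seq_def g_def)
    fix i j :: nat assume "i < j"
    then have "g i = H (Suc j) i" using agree[of i "Suc j"] by (simp add: g_def)
    then show "\<not> subseq (g i) (g j)"
      using H(1)[of "Suc j"] \<open>i < j\<close> by (simp add: P_def bad_seq_def g_def)
  qed
  moreover have "length (g n) \<le> length (h n)" if "bad_seq A h" "\<forall>j<n. h j = g j" for n h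
  proof -
    have "\<forall>j<n. h j = H (Suc n) j" using that(2) agree[of _ "Suc n"] by (simp add: g_def)
    then show ?thesis using H(1)[of "Suc n"] that(1) by (simp add: P_def g_def)
  qed
  ultimately show ?thesis by blast
qed

text \<open>In a minimal bad sequence no word is empty, and infinitely many words share their first
  letter. Keeping only these words from the first of them on, with that letter cut off, leaves the
  sequence bad but shortens an entry, against minimality.\<close>

lemma higman_finite:
  fixes f :: "nat \<Rightarrow> 'a list"
  assumes "finite A" "\<And>n. f n \<in> lists A"
  shows "\<exists>i j. i < j \<and> subseq (f i) (f j)"
proof (rule ccontr)
  assume "\<not> ?thesis"
  then have "bad_seq A f" using assms(2) by (auto simp: bad_seq_def)
  then obtain g where g: "bad_seq A g"
    and min: "\<And>n h. bad_seq A h \<Longrightarrow> (\<forall>j<n. h j = g j) \<Longrightarrow> length (g n) \<le> length (h n)"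
    using ex_minimal_bad_seq by metis
  have bad: "\<not> subseq (g i) (g j)" if "i < j" for i j using g that by (auto simp: bad_seq_def)
  have ne: "g n \<noteq> []" for n using bad[of n "Suc n"] by auto
  have inA: "g n \<in> lists A" for n using g by (simp add: bad_seq_def)
  have "(hd \<circ> g) ` UNIV \<subseteq> A" using ne inA by (auto intro!: list.set_sel(1) dest!: in_listsD)
  then have fin: "finite ((\<lambda>n. hd (g n)) ` UNIV)" using assms(1) by (auto intro: finite_subset)
  obtain a where "infinite {n. hd (g n) = a}"
    using pigeonhole_infinite[OF infinite_UNIV_nat fin] by auto
  then obtain e :: "nat \<Rightarrow> nat" where e: "strict_mono e" "\<And>n. hd (g (e n)) = a"
    using infinite_enumerate[of "{n. hd (g n) = a}"] by auto
  define h where "h i = (if i < e 0 then g i else tl (g (e (i - e 0))))" for i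
  have "bad_seq A h"
    unfolding bad_seq_def
  proof (intro conjI allI impI)
    show "h n \<in> lists A" for n
      using inA ne by (auto simp: h_def in_lists_conv_set intro: list.set_sel(2))
    fix i j :: nat assume ij: "i < j"
    have le: "e 0 \<le> e n" for n using e(1) by (simp add: strict_mono_less_eq)
    have cons: "g (e n) = a # tl (g (e n))" for n using ne e(2) by (metis list.collapse)
    consider "j < e 0" | "i < e 0" "e 0 \<le> j" | "e 0 \<le> i" using ij by linarith
    then show "\<not> subseq (h i) (h j)"
    proof cases
      case 1
      then show ?thesis using bad ij by (simp add: h_def)
    next
      case 2
      \<comment> \<open>A word that embeds into a tail also embeds into the full word.\<close>
      have "i < e (j - e 0)" using 2 le less_le_trans by blast
      then show ?thesis using bad[of i "e (j - e 0)"] 2 cons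
        by (metis h_def list_emb_Cons not_less)
    next
      case 3
      have "e (i - e 0) < e (j - e 0)" using 3 ij e(1) by (simp add: strict_mono_less)
      then have "\<not> subseq (a # tl (g (e (i - e 0)))) (a # tl (g (e (j - e 0))))"
        using bad cons by metis
      then show ?thesis using 3 ij by (simp add: h_def)
    qed
  qed
  then have "length (g (e 0)) \<le> length (h (e 0))" by (rule min) (simp add: h_def)
  then show False using ne[of "e 0"] by (cases "g (e 0)") (auto simp: h_def)
qed

text \<open>The embedding is recorded as an increasing map on all of \<open>nat\<close>, also beyond
  the end of \<open>xs\<close>, because it will relabel indices of monomials. A skipped letter of
  \<open>ys\<close> shifts the map by one; a matched pair puts a new value 0 in front of the shifted
  map.\<close>

lemma subseq_imp_strict_mono:
  assumes "subseq xs ys"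
  shows "\<exists>\<sigma>::nat \<Rightarrow> nat. strict_mono \<sigma> \<and> (\<forall>i<length xs. \<sigma> i < length ys \<and> ys ! \<sigma> i = xs ! i)"
  using assms
proof (induction rule: list_emb.induct)
  case (list_emb_Nil ys)
  show ?case by (rule exI[of _ id]) (simp add: strict_mono_def)
next
  case (list_emb_Cons xs ys y)
  then obtain \<sigma> :: "nat \<Rightarrow> nat" where "strict_mono \<sigma>"
    "\<forall>i<length xs. \<sigma> i < length ys \<and> ys ! \<sigma> i = xs ! i" by blast
  then show ?case by (intro exI[of _ "Suc \<circ> \<sigma>"]) (simp add: strict_mono_def)
next
  case (list_emb_Cons2 x y xs ys)
  then obtain \<sigma> :: "nat \<Rightarrow> nat" where \<sigma>: "strict_mono \<sigma>"
    "\<forall>i<length xs. \<sigma> i < length ys \<and> ys ! \<sigma> i = xs ! i" by blast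
  have "strict_mono (case_nat 0 (Suc \<circ> \<sigma>))"
    using \<sigma>(1) by (auto simp: strict_mono_def split: nat.split)
  then show ?case using \<sigma>(2) list_emb_Cons2.hyps
    by (intro exI[of _ "case_nat 0 (Suc \<circ> \<sigma>)"]) (auto simp: less_Suc_eq_0_disj split: nat.split)
qed

text \<open>If no finite set suffices, one can go on choosing elements of \<open>L\<close> that lie
  above no earlier choice, and the resulting sequence contradicts \<open>good\<close>.\<close>

lemma finite_basis_of_good:
  assumes good: "\<And>f::nat \<Rightarrow> 'a. (\<And>n. f n \<in> L) \<Longrightarrow> \<exists>i j. i < j \<and> le (f i) (f j)"
  shows "\<exists>L0. finite L0 \<and> L0 \<subseteq> L \<and> (\<forall>m\<in>L. \<exists>m0\<in>L0. le m0 m)"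
proof (rule ccontr)
  assume neg: "\<not> ?thesis"
  \<comment> \<open>A state consists of the elements chosen so far and the next one, already
    selected.\<close>
  define P where "P s \<longleftrightarrow> finite (fst s) \<and> fst s \<subseteq> L \<and> snd s \<in> L \<and> (\<forall>a\<in>fst s. \<not> le a (snd s))"
    for s :: "'a set \<times> 'a"
  have ext: "\<exists>m. P (A, m)" if "finite A" "A \<subseteq> L" for A
    using neg that by (auto simp: P_def)
  have "\<exists>s. \<forall>n. P (s n) \<and> fst (s (Suc n)) = insert (snd (s n)) (fst (s n))"
  proof (rule dependent_nat_choice)
    show "\<exists>x. P x" using ext[of "{}"] by auto
    fix x :: "'a set \<times> 'a" and n :: nat assume "P x"
    then obtain m where "P (insert (snd x) (fst x), m)"
      using ext[of "insert (snd x) (fst x)"] by (auto simp: P_def)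
    then show "\<exists>y. P y \<and> fst y = insert (snd x) (fst x)" by force
  qed
  then obtain s where s: "\<And>n. P (s n)" "\<And>n. fst (s (Suc n)) = insert (snd (s n)) (fst (s n))"
    by blast
  have mem: "snd (s i) \<in> fst (s j)" if "i < j" for i j
    using that by (induction j) (auto simp: s(2) less_Suc_eq)
  obtain i j where "i < j" "le (snd (s i)) (snd (s j))"
    using good[of "\<lambda>n. snd (s n)"] s(1) by (auto simp: P_def)
  then show False using mem s(1)[of j] by (auto simp: P_def)
qed

text \<open>The triple \<open>(S, i, w)\<close> stands for the element \<open>e_S \<otimes> e_w\<close> of the exterior algebra
  tensored with the \<open>i\<close>-th summand of a direct sum of tensor powers.\<close>

type_synonym mono = "nat set \<times> nat \<times> nat list"

text \<open>This is an increasing relabelling followed by multiplication with e_T, where T is the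
  part of \<open>S'\<close> outside the image of \<open>S\<close>: exactly the two operations that
  will be shown to preserve leading monomials.\<close>

definition mono_le :: "mono \<Rightarrow> mono \<Rightarrow> bool" where
  "mono_le m m' \<longleftrightarrow> (case (m, m') of ((S, i, w), (S', i', w')) \<Rightarrow>
     i' = i \<and> finite S' \<and> (\<exists>\<sigma>. strict_mono \<sigma> \<and> w' = map \<sigma> w \<and> \<sigma> ` S \<subseteq> S'))"

definition monomials :: "(nat \<Rightarrow> nat) \<Rightarrow> nat set \<Rightarrow> mono set" where
  "monomials dg I = {(S, i, w). finite S \<and> i \<in> I \<and> length w = dg i}"

text \<open>A monomial is recorded as the word whose \<open>p\<close>-th letter says whether \<open>p\<close> lies in \<open>S\<close> and
  at which places of \<open>w\<close> it occurs. Subword embeddings are then exactly the increasing maps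
  matching these data.\<close>

lemma mono_le_good:
  assumes I: "finite I" and f: "\<And>n::nat. f n \<in> monomials dg I"
  shows "\<exists>i j. i < j \<and> mono_le (f i) (f j)"
proof -
  define letter :: "mono \<Rightarrow> nat \<Rightarrow> bool \<times> nat set \<times> nat" where
    "letter m p = (case m of (S, i, w) \<Rightarrow> (p \<in> S, {j. j < length w \<and> w ! j = p}, i))" for m p
  \<comment> \<open>\<open>Suc\<close> makes the word nonempty even if no index occurs; its letter
    at 0 then still shows the summand.\<close>
  define bound :: "mono \<Rightarrow> nat" where
    "bound m = (case m of (S, i, w) \<Rightarrow> Suc (Max (insert 0 (S \<union> set w))))" for m
  define code where "code m = map (letter m) [0..<bound m]" for m
  \<comment> \<open>Places in \<open>w\<close> are smaller than the degree of its summand, and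
    finitely many summands bound the degrees; hence the alphabet is finite.\<close>
  define A where "A = (UNIV :: bool set) \<times> Pow {..<Max (insert 0 (dg ` I))} \<times> I"
  have "finite A" using I by (simp add: A_def)
  moreover have "code (f n) \<in> lists A" for n
  proof -
    obtain S i w where m: "f n = (S, i, w)" by (cases "f n") auto
    then have "i \<in> I" "length w = dg i" using f[of n] by (auto simp: monomials_def)
    then have "length w \<le> Max (insert 0 (dg ` I))" using I by (intro Max_ge) auto
    then show ?thesis using m \<open>i \<in> I\<close> by (auto simp: code_def A_def letter_def)
  qed
  ultimately obtain a b where ab: "a < b" "subseq (code (f a)) (code (f b))"
    using higman_finite[of A "\<lambda>n. code (f n)"] by blast
  obtain S i w S' i' w' where m: "f a = (S, i, w)" "f b = (S', i', w')" by (metis prod_cases3)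
  then have fin: "finite S" "length w = dg i" "finite S'" "length w' = dg i'"
    using f[of a] f[of b] by (auto simp: monomials_def)
  obtain \<sigma> where \<sigma>: "strict_mono \<sigma>"
    "\<And>p. p < bound (f a) \<Longrightarrow> letter (f b) (\<sigma> p) = letter (f a) p"
    using subseq_imp_strict_mono[OF ab(2)] by (fastforce simp: code_def)
  have bound: "p < bound (f a)" if "p \<in> S \<union> set w" for p
    using that fin by (auto simp: bound_def m less_Suc_eq_le)
  have "0 < bound (f a)" by (simp add: bound_def m)
  then have "i' = i" using \<sigma>(2)[of 0] by (simp add: letter_def m)
  moreover have "\<sigma> ` S \<subseteq> S'" using \<sigma>(2) bound by (auto simp: letter_def m)
  moreover have "w' = map \<sigma> w"
  proof (rule nth_equalityI)
    show "length w' = length (map \<sigma> w)" using fin \<open>i' = i\<close> by simp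
    fix j assume "j < length w'"
    then have j: "j < length w" using fin \<open>i' = i\<close> by simp
    then have "j \<in> fst (snd (letter (f a) (w ! j)))" by (simp add: letter_def m)
    then have "j \<in> fst (snd (letter (f b) (\<sigma> (w ! j))))" using \<sigma>(2) bound j by simp
    then show "w' ! j = map \<sigma> w ! j" using j by (simp add: letter_def m)
  qed
  ultimately have "mono_le (f a) (f b)" using \<sigma>(1) fin by (auto simp: mono_le_def m)
  then show ?thesis using ab(1) by blast
qed

section \<open>Well-founded orders on words and monomials\<close>

definition word_order :: "((nat \<times> nat list) \<times> (nat \<times> nat list)) set" where
  "word_order = less_than <*lex*> lenlex less_than"

lemma word_order: "wf word_order" "trans word_order" "total word_order"
  by (auto simp: word_order_def wf_lenlex lenlex_transI intro!: wf_lex_prod trans_lex_prod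
      total_lex_prod total_lenlex)

text \<open>Words decide before sets, and sets are compared by their binary codes, which gives
  well-foundedness at once. All infinite sets have code 0, so totality is claimed on
  \<open>monomials\<close> only.\<close>

definition mono_order :: "(mono \<times> mono) set" where
  "mono_order = inv_image (word_order <*lex*> less_than) (\<lambda>(S, iw). (iw, set_encode S))"

lemma mono_order: "wf mono_order" "trans mono_order" "total_on (monomials dg I) mono_order"
proof -
  show "wf mono_order" "trans mono_order"
    using word_order by (auto simp: mono_order_def intro!: wf_inv_image wf_lex_prod trans_inv_image)
  show "total_on (monomials dg I) mono_order"
  proof (rule total_onI)
    fix x y assume "x \<in> monomials dg I" "y \<in> monomials dg I" "x \<noteq> y"
    moreover have "snd x = snd y \<or> (snd x, snd y) \<in> word_order \<or> (snd y, snd x) \<in> word_order"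
      using word_order(3) unfolding total_on_def by blast
    ultimately show "(x, y) \<in> mono_order \<or> (y, x) \<in> mono_order"
      using set_encode_eq[of "fst x" "fst y"]
      by (cases x; cases y) (auto simp: mono_order_def monomials_def in_inv_image neq_iff)
  qed
qed

lemma mono_order_iff:
  "((S, i, w), (S', i', w')) \<in> mono_order \<longleftrightarrow>
    ((i, w), (i', w')) \<in> word_order \<or> (i, w) = (i', w') \<and> set_encode S < set_encode S'"
  by (auto simp: mono_order_def in_inv_image)

lemma set_encode_mono:
  "finite T \<Longrightarrow> S \<subseteq> T \<Longrightarrow> set_encode S \<le> set_encode T"
  by (simp add: set_encode_def sum_mono2)

text \<open>The highest binary digit at which the codes differ decides. This expresses the
  comparison by the order of \<open>nat\<close> alone, which makes its invariance under increasing
  maps visible.\<close>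

lemma set_encode_less_iff:
  assumes "finite S" "finite T"
  shows "set_encode S < set_encode T \<longleftrightarrow> (\<exists>x\<in>T - S. \<forall>y>x. y \<in> S \<longleftrightarrow> y \<in> T)"
proof -
  have if1: "set_encode S < set_encode T"
    if fin: "finite S" "finite T" and x: "x \<in> T - S" "\<forall>y>x. y \<in> S \<longleftrightarrow> y \<in> T" for S T x
  proof -
    \<comment> \<open>Below \<open>x\<close> the set \<open>S\<close> contributes less than
      \<open>2 ^ x\<close>; above \<open>x\<close> it agrees with \<open>T\<close>; and
      \<open>T\<close> contains \<open>x\<close> itself.\<close>
    have S: "S = (S \<inter> {..<x}) \<union> (S \<inter> {x<..})" using x by (auto simp: not_less_iff_gr_or_eq)
    have T: "insert x (S \<inter> {x<..}) \<subseteq> T" using x by auto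
    have "set_encode (S \<inter> {..<x}) \<le> set_encode {..<x}" by (rule set_encode_mono) auto
    also have "\<dots> < 2 ^ x" using sum_power2[of x] by (simp add: set_encode_def lessThan_atLeast0)
    finally have "set_encode S < 2 ^ x + set_encode (S \<inter> {x<..})"
      by (subst S, subst set_encode_def, subst sum.union_disjoint)
        (auto simp: fin set_encode_def)
    also have "\<dots> = set_encode (insert x (S \<inter> {x<..}))"
      by (rule set_encode_insert[symmetric]) (use fin in auto)
    also have "\<dots> \<le> set_encode T" by (rule set_encode_mono) (use T fin in auto)
    finally show ?thesis .
  qed
  have cmp: "(\<exists>x\<in>T - S. \<forall>y>x. y \<in> S \<longleftrightarrow> y \<in> T) \<or> (\<exists>x\<in>S - T. \<forall>y>x. y \<in> T \<longleftrightarrow> y \<in> S)"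
    if "S \<noteq> T"
  proof -
    let ?D = "(S - T) \<union> (T - S)"
    have D: "finite ?D" "?D \<noteq> {}" using assms that by auto
    have "Max ?D \<in> ?D" by (rule Max_in[OF D])
    moreover have "y \<in> S \<longleftrightarrow> y \<in> T" if "y > Max ?D" for y
      using Max_ge[OF D(1), of y] that by auto
    ultimately show ?thesis by blast
  qed
  show ?thesis
  proof
    assume less: "set_encode S < set_encode T"
    then have "S \<noteq> T" by auto
    then show "\<exists>x\<in>T - S. \<forall>y>x. y \<in> S \<longleftrightarrow> y \<in> T"
      using cmp if1[of T S] assms less by (meson order_less_asym)
  qed (use if1 assms in blast)
qed

lemma set_encode_image_less:
  assumes "finite S" "finite T" "strict_mono_on (S \<union> T) \<pi>" "set_encode S < set_encode T"
  shows "set_encode (\<pi> ` S) < set_encode (\<pi> ` T)"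
proof -
  obtain x where x: "x \<in> T - S" "\<forall>y>x. y \<in> S \<longleftrightarrow> y \<in> T"
    using assms by (auto simp: set_encode_less_iff)
  have inj: "inj_on \<pi> (S \<union> T)" using assms(3) by (rule strict_mono_on_imp_inj_on)
  have "\<pi> x \<in> \<pi> ` T - \<pi> ` S" using x inj by (auto simp: inj_on_def)
  moreover have "y \<in> \<pi> ` S \<longleftrightarrow> y \<in> \<pi> ` T" if "y > \<pi> x" for y
  proof -
    have "z > x" if "z \<in> S \<union> T" "\<pi> z > \<pi> x" for z
      using that x strict_mono_onD[OF assms(3), of z x] by (metis DiffD1 UnI2 less_asym linorder_neqE_nat)
    then show ?thesis using that x(2) by blast
  qed
  ultimately show ?thesis using assms(1,2) by (auto simp: set_encode_less_iff)
qed

lemma lenlex_map: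
  assumes "(u, v) \<in> lenlex less_than" "strict_mono_on (set u \<union> set v) \<pi>"
  shows "(map \<pi> u, map \<pi> v) \<in> lenlex less_than"
  using assms
proof (induction u arbitrary: v)
  case Nil
  then show ?case by (auto simp: lenlex_conv)
next
  case (Cons a u)
  show ?case
  proof (cases v)
    case Nil
    then show ?thesis using Cons by (simp add: lenlex_conv)
  next
    case (Cons b v')
    have mono: "strict_mono_on (set u \<union> set v') \<pi>"
      using Cons.prems(2) Cons by (auto simp: strict_mono_on_def)
    show ?thesis
      using Cons.prems Cons.IH[OF _ mono] Cons
      by (auto simp: Cons_lenlex_iff strict_mono_on_def)
  qed
qed

text \<open>\<open>\<pi>\<close> is increasing only on the indices in question because it will be a
  permutation, and the identity is the only permutation of \<open>nat\<close> that is increasing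
  everywhere.\<close>

lemma mono_order_map:
  assumes "((S, i, w), (S', i', w')) \<in> mono_order" "finite S" "finite S'"
    "strict_mono_on (S \<union> S' \<union> set w \<union> set w') \<pi>"
  shows "((\<pi> ` S, i, map \<pi> w), (\<pi> ` S', i', map \<pi> w')) \<in> mono_order"
proof -
  have "strict_mono_on (S \<union> S') \<pi>" "strict_mono_on (set w \<union> set w') \<pi>"
    using assms(4) by (auto simp: strict_mono_on_def)
  then show ?thesis
    using assms(1-3) lenlex_map[of w w' \<pi>] set_encode_image_less[of S S' \<pi>]
    by (auto simp: mono_order_iff word_order_def)
qed

text \<open>A disjoint \<open>T\<close> adds the same number \<open>set_encode T\<close> to both
  codes.\<close>

lemma mono_order_union:
  assumes "((S, i, w), (S', i', w')) \<in> mono_order" "finite S" "finite S'" "finite T"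
    "T \<inter> S = {}" "T \<inter> S' = {}"
  shows "((T \<union> S, i, w), (T \<union> S', i', w')) \<in> mono_order"
  using assms by (auto simp: mono_order_iff set_encode_def sum.union_disjoint)

section \<open>Matrices acting on tensors and on the exterior algebra\<close>

text \<open>It sends e_b to \<open>d b\<close> times the basis vector at \<open>\<pi> b\<close>; one
  computation thus covers permutation matrices (\<open>d\<close> constantly 1) and diagonal matrices
  (\<open>\<pi> = id\<close>).\<close>

definition monomial_mat :: "(nat \<Rightarrow> nat) \<Rightarrow> (nat \<Rightarrow> 'k::field) \<Rightarrow> nat \<Rightarrow> nat \<Rightarrow> 'k" where
  "monomial_mat \<pi> d a b = (if a = \<pi> b then d b else 0)"

abbreviation perm_mat :: "(nat \<Rightarrow> nat) \<Rightarrow> nat \<Rightarrow> nat \<Rightarrow> 'k::field" where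
  "perm_mat \<pi> \<equiv> monomial_mat \<pi> (\<lambda>_. 1)"

lemma mat_mul_monomial_mat:
  assumes "bij \<pi>" "\<And>b. d b \<noteq> 0"
  shows "mat_mul (monomial_mat \<pi> d) h i j = d (inv \<pi> i) * h (inv \<pi> i) j"
proof -
  have "{l. monomial_mat \<pi> d i l \<noteq> 0} = {inv \<pi> i}"
    using assms by (auto simp: monomial_mat_def bij_is_inj bij_is_surj surj_f_inv_f)
  then show ?thesis
    using assms(1) by (simp add: mat_mul_def monomial_mat_def bij_is_surj surj_f_inv_f)
qed

lemma monomial_mat_eventually_id:
  assumes "\<pi> permutes {..<n}" "\<And>b. n \<le> b \<Longrightarrow> d b = 1"
  shows "eventually_id (monomial_mat \<pi> d)"
  unfolding eventually_id_def
proof (intro exI[of _ n] allI impI)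
  fix i j assume "n \<le> i \<or> n \<le> j"
  moreover have "\<pi> j < n \<longleftrightarrow> j < n" using permutes_in_image[OF assms(1), of j] by simp
  moreover have "\<pi> j = j" if "n \<le> j" using permutes_not_in[OF assms(1)] that by simp
  ultimately show "monomial_mat \<pi> d i j = idm i j"
    using assms(2)[of j] by (cases "n \<le> j") (auto simp: monomial_mat_def idm_def)
qed

lemma monomial_mat_GL:
  assumes \<pi>: "\<pi> permutes {..<n}" and d: "\<And>b. d b \<noteq> 0" "\<And>b. n \<le> b \<Longrightarrow> d b = 1"
  shows "monomial_mat \<pi> d \<in> GL"
proof -
  let ?e = "\<lambda>a. 1 / d (inv \<pi> a)"
  have inv: "inv \<pi> permutes {..<n}" by (rule permutes_inv[OF \<pi>])
  have bij: "bij \<pi>" "bij (inv \<pi>)" using \<pi> inv by (auto intro: permutes_bij)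
  have inv_inv: "inv (inv \<pi>) = \<pi>" using bij(1) by (rule inv_inv_eq)
  have simps: "\<pi> (inv \<pi> x) = x" "inv \<pi> (\<pi> x) = x" for x
    using permutes_inverses[OF \<pi>] by auto
  have eq: "inv \<pi> x = inv \<pi> y \<longleftrightarrow> x = y" for x y using simps by metis
  have "?e b = 1" if "n \<le> b" for b using that permutes_not_in[OF inv] d by simp
  then have "eventually_id (monomial_mat (inv \<pi>) ?e)"
    by (rule monomial_mat_eventually_id[OF inv])
  moreover have "mat_mul (monomial_mat \<pi> d) (monomial_mat (inv \<pi>) ?e) = idm"
    by (intro ext) (auto simp: mat_mul_monomial_mat[OF bij(1) d(1)] monomial_mat_def idm_def d eq)
  moreover have "mat_mul (monomial_mat (inv \<pi>) ?e) (monomial_mat \<pi> d) = idm"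
    by (intro ext, subst mat_mul_monomial_mat[OF bij(2)])
      (auto simp: monomial_mat_def idm_def d inv_inv simps inj_eq[OF bij_is_inj[OF bij(1)]])
  moreover have "eventually_id (monomial_mat \<pi> d)"
    by (rule monomial_mat_eventually_id[OF \<pi> d(2)])
  ultimately show ?thesis unfolding GL_def by blast
qed

lemma perm_mat_GL: "\<pi> permutes {..<n} \<Longrightarrow> perm_mat \<pi> \<in> GL"
  by (rule monomial_mat_GL) auto

text \<open>A row of such a matrix has a single nonzero entry, so only one word \<open>v\<close>
  contributes to the coefficient at \<open>w\<close>.\<close>

lemma tact_monomial_mat:
  assumes "bij \<pi>" "fin_supp x"
  shows "tact (monomial_mat \<pi> d) x (i, w) =
    (\<Prod>m<length w. d (inv \<pi> (w ! m))) * x (i, map (inv \<pi>) w)"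
proof -
  let ?V = "{v. x (i, v) \<noteq> 0 \<and> length v = length w}"
  let ?u = "map (inv \<pi>) w" and ?c = "\<Prod>m<length w. d (inv \<pi> (w ! m))"
  have inv: "a = \<pi> b \<longleftrightarrow> b = inv \<pi> a" for a b
    using assms(1) by (auto simp: bij_is_inj bij_is_surj surj_f_inv_f)
  have "finite (Pair i -` {z. x z \<noteq> 0})"
    using assms(2) by (intro finite_vimageI) (auto simp: fin_supp_def inj_on_def)
  then have fin: "finite ?V" by (rule rev_finite_subset) auto
  have prod: "(\<Prod>m<length w. monomial_mat \<pi> d (w ! m) (v ! m)) = (if v = ?u then ?c else 0)"
    if len: "length v = length w" for v
  proof (cases "v = ?u")
    case True
    then show ?thesis by (auto simp: monomial_mat_def inv intro!: prod.cong)
  next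
    case False
    then obtain m where "m < length w" "v ! m \<noteq> inv \<pi> (w ! m)"
      using len by (auto simp: list_eq_iff_nth_eq)
    then show ?thesis using False by (auto simp: monomial_mat_def inv intro!: prod_zero)
  qed
  have "tact (monomial_mat \<pi> d) x (i, w) = (\<Sum>v\<in>?V. if v = ?u then ?c * x (i, v) else 0)"
    unfolding tact_def by (simp, rule sum.cong) (auto simp: prod)
  also have "\<dots> = ?c * x (i, ?u)" using fin by (simp add: sum.delta)
  finally show ?thesis .
qed

lemma tact_perm_mat:
  assumes "bij \<pi>" "fin_supp x"
  shows "tact (perm_mat \<pi>) x (i, w) = x (i, map (inv \<pi>) w)"
  using tact_monomial_mat[OF assms] by simp

lemma tact_diagonal:
  assumes "fin_supp x"
  shows "tact (monomial_mat id ((\<lambda>_. 1)(j := t))) x (i, w) = t ^ count_list w j * x (i, w)"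
proof -
  have "(\<Prod>m<length w. ((\<lambda>_. 1)(j := t)) (w ! m)) = t ^ count_list w j"
    by (induction w) (auto simp: prod.lessThan_Suc_shift simp del: prod.lessThan_Suc)
  then show ?thesis using tact_monomial_mat[OF bij_id assms, of "(\<lambda>_. 1)(j := t)" i w]
    by (simp del: fun_upd_apply)
qed

text \<open>Turns an injection on finitely many indices into an element of GL: within a common
  initial segment the complements of \<open>A\<close> and of its image have equal size and can be
  matched.\<close>

lemma ex_permutes_extending:
  fixes f :: "nat \<Rightarrow> nat"
  assumes "finite A" "inj_on f A"
  shows "\<exists>\<pi> n. \<pi> permutes {..<n} \<and> (\<forall>x\<in>A. \<pi> x = f x)"
proof -
  obtain n where n: "A \<union> f ` A \<subseteq> {..<n}"
    using assms(1) finite_nat_iff_bounded[of "A \<union> f ` A"] by auto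
  have "card ({..<n} - A) = card ({..<n} - f ` A)"
    using n assms by (simp add: card_Diff_subset card_image)
  then obtain h where h: "bij_betw h ({..<n} - A) ({..<n} - f ` A)"
    by (metis finite_same_card_bij finite_Diff finite_lessThan)
  define \<pi> where "\<pi> x = (if x \<in> A then f x else if x < n then h x else x)" for x
  have "bij_betw \<pi> A (f ` A)"
    using inj_on_imp_bij_betw[OF assms(2)] by (subst bij_betw_cong[of _ _ f]) (auto simp: \<pi>_def)
  moreover have "bij_betw \<pi> ({..<n} - A) ({..<n} - f ` A)"
    using h by (subst bij_betw_cong[of _ _ h]) (auto simp: \<pi>_def)
  ultimately have "bij_betw \<pi> (A \<union> ({..<n} - A)) (f ` A \<union> ({..<n} - f ` A))"
    by (rule bij_betw_combine) auto
  moreover have "A \<union> ({..<n} - A) = {..<n}" "f ` A \<union> ({..<n} - f ` A) = {..<n}" using n by auto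
  ultimately have "bij_betw \<pi> {..<n} {..<n}" by simp
  then have "\<pi> permutes {..<n}"
    by (rule bij_imp_permutes) (use n in \<open>auto simp: \<pi>_def\<close>)
  then show ?thesis by (auto simp: \<pi>_def)
qed

text \<open>A zero row makes a determinant vanish; the entry is read off from a nonvanishing term of
  the Leibniz sum.\<close>

lemma minor_det_nonzeroD:
  assumes "minor_det g T S \<noteq> 0" "finite S" "finite T" "card T = card S" "t \<in> T"
  shows "\<exists>s\<in>S. g t s \<noteq> 0"
proof -
  let ?s = "sorted_list_of_set S" and ?t = "sorted_list_of_set T"
  obtain p where p: "p permutes {..<card S}" "(\<Prod>m<card S. g (?t ! p m) (?s ! m)) \<noteq> 0"
    using assms(1) unfolding minor_det_def
    by (rule sum.not_neutral_contains_not_neutral) auto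
  obtain k where k: "k < card S" "?t ! k = t"
    using assms(3-5) by (metis in_set_conv_nth length_sorted_list_of_set set_sorted_list_of_set)
  have "inv p k < card S" "p (inv p k) = k"
    using k permutes_in_image[OF permutes_inv[OF p(1)], of k] permutes_inverses[OF p(1)] by auto
  moreover have "g (?t ! p m) (?s ! m) \<noteq> 0" if "m < card S" for m using that p(2) by simp
  ultimately have "g t (?s ! inv p k) \<noteq> 0" using k(2) by metis
  moreover have "?s ! inv p k \<in> S"
    using \<open>inv p k < card S\<close> assms(2)
    by (metis nth_mem length_sorted_list_of_set set_sorted_list_of_set)
  ultimately show ?thesis by blast
qed

text \<open>The point is finite support. From \<open>n\<close> on the rows of \<open>g\<close> are
  those of the identity, so an index of \<open>T\<close> beyond \<open>n\<close> must already lie in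
  \<open>S\<close>, which keeps \<open>T\<close> inside one finite set.\<close>

lemma ract_in_Rel:
  assumes "g \<in> GL" "r \<in> Rel"
  shows "ract g r \<in> Rel"
proof -
  obtain n where n: "\<And>i j. n \<le> i \<Longrightarrow> g i j = idm i j"
    using assms(1) by (auto simp: GL_def eventually_id_def)
  let ?U = "\<Union>{S. r S \<noteq> 0} \<union> {..<n}"
  have fin: "finite S" if "r S \<noteq> 0" for S using that assms(2) by (simp add: Rel_def)
  have "T \<subseteq> ?U" if "ract g r T \<noteq> 0" for T
  proof -
    have T: "finite T" using that by (auto simp: ract_def split: if_splits)
    then have "(\<Sum>S\<in>{S. r S \<noteq> 0 \<and> card S = card T}. minor_det g T S * r S) \<noteq> 0"
      using that by (simp add: ract_def)
    then obtain S where S: "r S \<noteq> 0" "card S = card T" "minor_det g T S \<noteq> 0"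
      by (rule sum.not_neutral_contains_not_neutral) auto
    show ?thesis
    proof
      fix t assume "t \<in> T"
      then obtain s where "s \<in> S" "g t s \<noteq> 0"
        using minor_det_nonzeroD[OF S(3) fin[OF S(1)] T] S(2) by metis
      then show "t \<in> ?U" using n[of t s] S(1) by (cases "n \<le> t") (auto simp: idm_def split: if_splits)
    qed
  qed
  then have "{T. ract g r T \<noteq> 0} \<subseteq> Pow ?U" by blast
  moreover have "finite ?U" using assms(2) fin by (auto simp: Rel_def fin_supp_def)
  ultimately have "fin_supp (ract g r)"
    unfolding fin_supp_def by (meson finite_Pow_iff finite_subset)
  then show ?thesis by (auto simp: Rel_def ract_def split: if_splits)
qed

lemma Rbasis_in_Rel: "finite S \<Longrightarrow> Rbasis S \<in> Rel"
  by (simp add: Rel_def Rbasis_def fin_supp_def)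

lemma Rscal_in_Rel: "Rscal c \<in> Rel"
  by (simp add: Rel_def Rscal_def fin_supp_def)

lemma sorted_list_of_set_image_strict_mono_on:
  fixes \<pi> :: "nat \<Rightarrow> nat"
  assumes "finite S" "strict_mono_on S \<pi>"
  shows "sorted_list_of_set (\<pi> ` S) = map \<pi> (sorted_list_of_set S)"
proof (rule sorted_distinct_set_unique)
  show "sorted (map \<pi> (sorted_list_of_set S))"
    using assms by (intro sorted_map_mono) (auto intro: strict_mono_on_imp_mono_on)
  show "distinct (map \<pi> (sorted_list_of_set S))"
    using assms by (simp add: distinct_map strict_mono_on_imp_inj_on)
qed (use assms in auto)

text \<open>Because \<open>\<pi>\<close> is increasing on \<open>S\<close>, no sign appears.\<close>

lemma ract_perm_mat:
  assumes "bij \<pi>" "finite S" "strict_mono_on S \<pi>"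
  shows "ract (perm_mat \<pi>) (Rbasis S) = (Rbasis (\<pi> ` S) :: nat set \<Rightarrow> 'k::field)"
proof
  fix T
  let ?g = "perm_mat \<pi> :: nat \<Rightarrow> nat \<Rightarrow> 'k"
  let ?s = "sorted_list_of_set S"
  have inj: "inj_on \<pi> S" using assms(1) by (meson bij_is_inj inj_on_subset subset_UNIV)
  have card: "card (\<pi> ` S) = card S" using inj by (rule card_image)
  have minor: "minor_det ?g (\<pi> ` S) S = 1"
  proof -
    have nth: "sorted_list_of_set (\<pi> ` S) ! k = \<pi> (?s ! k)" if "k < card S" for k
      using that assms by (simp add: sorted_list_of_set_image_strict_mono_on)
    \<comment> \<open>Both sorted lists correspond under \<open>\<pi>\<close>, so the minor is that
      of an identity matrix.\<close>
    have prod: "of_int (sign p) * (\<Prod>m<card S. ?g (sorted_list_of_set (\<pi> ` S) ! p m) (?s ! m)) =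
      (if p = id then 1 else 0)" if p: "p permutes {..<card S}" for p
    proof (cases "p = id")
      case True
      then show ?thesis by (simp add: nth monomial_mat_def)
    next
      case False
      then obtain m where m: "p m \<noteq> m" by (auto simp: fun_eq_iff)
      then have lt: "m < card S" "p m < card S"
        using permutes_not_in[OF p] permutes_in_image[OF p, of m] by auto
      then have "?s ! p m \<noteq> ?s ! m"
        using m assms(2) by (simp add: nth_eq_iff_index_eq)
      then have "?g (sorted_list_of_set (\<pi> ` S) ! p m) (?s ! m) = 0"
        using lt assms(1) by (auto simp: nth monomial_mat_def bij_def inj_eq)
      then show ?thesis using False lt(1) by (auto intro!: prod_zero)
    qed
    have "minor_det ?g (\<pi> ` S) S =
      (\<Sum>p\<in>{p. p permutes {..<card S}}. if p = id then 1 else 0)"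
      unfolding minor_det_def by (rule sum.cong) (auto simp: prod)
    also have "\<dots> = 1" by (subst sum.delta) (auto simp: finite_permutations permutes_id)
    finally show ?thesis .
  qed
  have zero: "minor_det ?g T S = 0" if "finite T" "card T = card S" "T \<noteq> \<pi> ` S"
  proof (rule ccontr)
    assume "minor_det ?g T S \<noteq> 0"
    then have "\<exists>s\<in>S. ?g t s \<noteq> 0" if "t \<in> T" for t
      using minor_det_nonzeroD[of ?g T S t] assms(2) \<open>finite T\<close> \<open>card T = card S\<close> that by blast
    then have "T \<subseteq> \<pi> ` S" by (fastforce simp: monomial_mat_def split: if_splits)
    then show False using card_subset_eq[of "\<pi> ` S" T] that card assms(2) by simp
  qed
  have "{S'. (Rbasis S S' :: 'k) \<noteq> 0 \<and> card S' = card T} = (if card S = card T then {S} else {})"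
    by (auto simp: Rbasis_def)
  then have "ract ?g (Rbasis S) T = (if finite T \<and> card S = card T then minor_det ?g T S else 0)"
    by (simp add: ract_def Rbasis_def)
  then show "ract ?g (Rbasis S) T = Rbasis (\<pi> ` S) T"
    using minor zero card assms(2) by (auto simp: Rbasis_def)
qed

lemma Rmul_Rbasis:
  "Rmul (Rbasis T) (Rbasis S) =
    (\<lambda>U. if T \<inter> S = {} \<and> U = T \<union> S then wsign T S else (0::'k::field))"
proof
  fix U
  have "{(A, B). (Rbasis T A :: 'k) \<noteq> 0 \<and> (Rbasis S B :: 'k) \<noteq> 0 \<and> A \<inter> B = {} \<and> A \<union> B = U} =
    (if T \<inter> S = {} \<and> U = T \<union> S then {(T, S)} else {})"
    by (auto simp: Rbasis_def split: if_splits)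
  then show "Rmul (Rbasis T) (Rbasis S) U =
    (if T \<inter> S = {} \<and> U = T \<union> S then wsign T S else (0::'k::field))"
    by (simp add: Rmul_def Rbasis_def)
qed

lemma wsign_empty [simp]: "wsign S {} = 1" "wsign {} S = 1"
  by (simp_all add: wsign_def)

lemma Rmul_Rscal_left: "Rmul (Rscal c) r = (\<lambda>U. c * r U)"
proof
  fix U
  have "{(S, T). Rscal c S \<noteq> 0 \<and> r T \<noteq> 0 \<and> S \<inter> T = {} \<and> S \<union> T = U} =
    (if c \<noteq> 0 \<and> r U \<noteq> 0 then {({}, U)} else {})"
    by (auto simp: Rscal_def split: if_splits)
  then show "Rmul (Rscal c) r U = c * r U" by (simp add: Rmul_def Rscal_def)
qed

lemma Rmul_Rscal_right: "Rmul r (Rscal c) = (\<lambda>U. c * r U)"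
proof
  fix U
  have "{(S, T). r S \<noteq> 0 \<and> Rscal c T \<noteq> 0 \<and> S \<inter> T = {} \<and> S \<union> T = U} =
    (if c \<noteq> 0 \<and> r U \<noteq> 0 then {(U, {})} else {})"
    by (auto simp: Rscal_def split: if_splits)
  then show "Rmul r (Rscal c) U = c * r U" by (simp add: Rmul_def Rscal_def)
qed

section \<open>Stable subspaces of sums of tensor powers and their weights\<close>

definition tensor_sub :: "(nat \<Rightarrow> nat) \<Rightarrow> nat set \<Rightarrow> (nat \<times> nat list \<Rightarrow> 'k::field) set \<Rightarrow> bool" where
  "tensor_sub dg I W \<longleftrightarrow> fun_subspace W \<and> W \<subseteq> TS dg \<and> (\<forall>x\<in>W. \<forall>i w. x (i, w) \<noteq> 0 \<longrightarrow> i \<in> I) \<and>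
     (\<forall>g\<in>GL. \<forall>x\<in>W. tact g x \<in> W)"

lemma tensor_subD:
  assumes "tensor_sub dg I W"
  shows "fun_subspace W" "x \<in> W \<Longrightarrow> fin_supp x"
    "x \<in> W \<Longrightarrow> x (i, w) \<noteq> 0 \<Longrightarrow> i \<in> I" "x \<in> W \<Longrightarrow> x (i, w) \<noteq> 0 \<Longrightarrow> length w = dg i"
    "g \<in> GL \<Longrightarrow> x \<in> W \<Longrightarrow> tact g x \<in> W"
  using assms unfolding tensor_sub_def TS_def by blast+

text \<open>The polynomial \<open>t ^ (b + 1) - t + 1\<close> is chosen so that every root will do:
  its value at 0 is 1, and where \<open>t ^ b = 1\<close> it equals
  \<open>t - t + 1\<close>.\<close>

lemma ex_power_neq_1:
  assumes "alg_closed_field TYPE('k::field)" "b > 0"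
  shows "\<exists>t::'k. t \<noteq> 0 \<and> t ^ b \<noteq> 1"
proof -
  let ?q = "monom 1 (Suc b) - monom 1 1 + [:1:] :: 'k poly"
  have "coeff ?q (Suc b) = 1" using assms(2) by (simp add: coeff_pCons)
  then have "degree ?q \<ge> Suc b" by (metis le_degree zero_neq_one)
  then obtain t where "poly ?q t = 0"
    using assms(1) unfolding alg_closed_field_def by (metis less_le_trans zero_less_Suc)
  then have "t * t ^ b - t + 1 = 0" by (simp add: poly_monom)
  then show ?thesis by (intro exI[of _ t]) auto
qed

text \<open>Subtracting \<open>t\<^sup>b x\<close> from the action of a diagonal matrix on \<open>x\<close> kills the words
  containing \<open>j\<close> exactly \<open>b\<close> times.\<close>

lemma tensor_sub_avoiding:
  assumes ac: "alg_closed_field TYPE('k::field)"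
    and W: "tensor_sub dg I (W :: (nat \<times> nat list \<Rightarrow> 'k) set)" and x: "x \<in> W"
  shows "(\<lambda>(i, w). if j \<in> set w then 0 else x (i, w)) \<in> W"
proof -
  let ?pr = "\<lambda>x::nat \<times> nat list \<Rightarrow> 'k. \<lambda>(i, w). if j \<in> set w then 0 else x (i, w)"
  \<comment> \<open>\<open>A\<close> collects the positive multiplicities of \<open>j\<close> that
    may still occur; each step removes one of them.\<close>
  have *: "\<forall>x\<in>W. (\<forall>i w. x (i, w) \<noteq> 0 \<longrightarrow> count_list w j \<in> insert 0 A) \<longrightarrow> ?pr x \<in> W"
    if "finite A" "0 \<notin> A" for A
    using that
  proof (induction A rule: finite_induct)
    case empty
    have "?pr x = x" if "\<forall>i w. x (i, w) \<noteq> 0 \<longrightarrow> count_list w j = 0" for x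
      using that by (auto simp: count_list_0_iff fun_eq_iff)
    then show ?case by simp
  next
    case (insert b A)
    show ?case
    proof (intro ballI impI)
      fix x assume x: "x \<in> W" "\<forall>i w. x (i, w) \<noteq> 0 \<longrightarrow> count_list w j \<in> insert 0 (insert b A)"
      have "b > 0" using insert by (cases b) auto
      then obtain t :: 'k where t: "t \<noteq> 0" "t ^ b \<noteq> 1" using ex_power_neq_1[OF ac] by blast
      define g where "g = monomial_mat id ((\<lambda>_. 1)(j := t))"
      have "g \<in> GL" unfolding g_def
        by (rule monomial_mat_GL[of _ "Suc j"]) (use t in \<open>auto simp: permutes_id\<close>)
      then have gx: "tact g x \<in> W" using W x tensor_subD(5) by blast
      \<comment> \<open>The factor restores coefficient 1 on words without \<open>j\<close>, where
        the diagonal matrix has eigenvalue \<open>t ^ 0\<close>.\<close>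
      define y where "y = (\<lambda>z. (1 / (1 - t ^ b)) * (tact g x z + (- (t ^ b)) * x z))"
      have "y \<in> W" unfolding y_def using gx x(1) tensor_subD(1)[OF W]
        by (intro fun_subspaceD)
      have y: "y (i, w) = (t ^ count_list w j - t ^ b) / (1 - t ^ b) * x (i, w)" for i w
        using tensor_subD(2)[OF W x(1)] by (simp add: y_def g_def tact_diagonal algebra_simps
            add_divide_distrib diff_divide_distrib)
      have "\<forall>i w. y (i, w) \<noteq> 0 \<longrightarrow> count_list w j \<in> insert 0 A"
        using x(2) by (auto simp: y)
      then have "?pr y \<in> W" using insert \<open>y \<in> W\<close> by blast
      moreover have "?pr y = ?pr x"
        using t by (auto simp: fun_eq_iff y count_list_0_iff[THEN iffD2])
      ultimately show "?pr x \<in> W" by simp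
    qed
  qed
  define A where "A = (\<lambda>(i, w). count_list w j) ` {z. x z \<noteq> 0} - {0}"
  have "finite A" using tensor_subD(2)[OF W x] by (simp add: A_def fin_supp_def)
  moreover have "\<forall>i w. x (i, w) \<noteq> 0 \<longrightarrow> count_list w j \<in> insert 0 A"
    by (force simp: A_def)
  moreover have "0 \<notin> A" by (simp add: A_def)
  ultimately show ?thesis using * x by blast
qed

text \<open>By splitting off letters, elements may be assumed to involve only words with one fixed
  set of letters; a permutation matrix moves these letters below \<open>D\<close>.\<close>

lemma tensor_sub_determined:
  assumes ac: "alg_closed_field TYPE('k::field)"
    and W: "tensor_sub dg I (W :: (nat \<times> nat list \<Rightarrow> 'k) set)" and W': "tensor_sub dg I W'"
    and D: "\<And>i. i \<in> I \<Longrightarrow> dg i \<le> D"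
    and sub: "\<And>x. x \<in> W' \<Longrightarrow> (\<forall>i w. x (i, w) \<noteq> 0 \<longrightarrow> set w \<subseteq> {..<D}) \<Longrightarrow> x \<in> W"
  shows "W' \<subseteq> W"
proof -
  note sW = tensor_subD(1)[OF W] and sW' = tensor_subD(1)[OF W']
  \<comment> \<open>\<open>A\<close> holds letters present in every word of \<open>x\<close>, and
    \<open>C\<close> the undecided ones. Splitting at a letter \<open>j\<close> of \<open>C\<close>
    gives a part \<open>x0\<close> avoiding \<open>j\<close> and a part \<open>x1\<close> with
    \<open>j\<close> in every word; when \<open>C\<close> is empty, all words have letter set
    \<open>A\<close>.\<close>
  have *: "x \<in> W" if "finite C" "x \<in> W'" "\<forall>i w. x (i, w) \<noteq> 0 \<longrightarrow> A \<subseteq> set w \<and> set w \<subseteq> A \<union> C"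
    for C A x
    using that
  proof (induction C arbitrary: A x rule: finite_induct)
    case empty
    show ?case
    proof (cases "x = (\<lambda>z. 0)")
      case True
      then show ?thesis using fun_subspaceD(1)[OF sW] by simp
    next
      case False
      then obtain i0 w0 where w0: "x (i0, w0) \<noteq> 0" by (auto simp: fun_eq_iff)
      then have "set w0 = A" using empty by auto
      moreover have "length w0 \<le> D" using tensor_subD(3,4)[OF W' empty(1) w0] D by metis
      ultimately have A: "finite A" "card A \<le> card {..<D}"
        using card_length[of w0] by auto
      then obtain f where f: "f ` A \<subseteq> {..<D}" "inj_on f A"
        using card_le_inj by (metis finite_lessThan)
      obtain \<pi> n where \<pi>: "\<pi> permutes {..<n}" "\<forall>a\<in>A. \<pi> a = f a"
        using ex_permutes_extending[OF A(1) f(2)] by blast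
      have bij: "bij \<pi>" "bij (inv \<pi>)" using \<pi>(1) permutes_inv[OF \<pi>(1)] by (auto intro: permutes_bij)
      have simps: "\<pi> (inv \<pi> a) = a" "inv \<pi> (\<pi> a) = a" for a
        using permutes_inverses[OF \<pi>(1)] by auto
      define y where "y = tact (perm_mat \<pi>) x"
      have y: "y (i, w) = x (i, map (inv \<pi>) w)" for i w
        unfolding y_def by (rule tact_perm_mat[OF bij(1) tensor_subD(2)[OF W' empty(1)]])
      have yW': "y \<in> W'" unfolding y_def
        by (rule tensor_subD(5)[OF W' perm_mat_GL[OF \<pi>(1)] empty(1)])
      have "set w \<subseteq> {..<D}" if "y (i, w) \<noteq> 0" for i w
      proof
        fix a assume "a \<in> set w"
        then have "inv \<pi> a \<in> A" using that empty(2) by (force simp: y)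
        then show "a \<in> {..<D}" using \<pi>(2) f(1) simps by (metis image_subset_iff)
      qed
      then have "y \<in> W" using sub yW' by blast
      then have "tact (perm_mat (inv \<pi>)) y \<in> W"
        by (rule tensor_subD(5)[OF W perm_mat_GL[OF permutes_inv[OF \<pi>(1)]]])
      moreover have "tact (perm_mat (inv \<pi>)) y = x"
      proof
        fix z
        have "tact (perm_mat (inv \<pi>)) y (fst z, snd z) = x (fst z, snd z)"
          by (subst tact_perm_mat[OF bij(2) tensor_subD(2)[OF W' yW']])
            (simp add: y inv_inv_eq[OF bij(1)] simps o_def)
        then show "tact (perm_mat (inv \<pi>)) y z = x z" by simp
      qed
      ultimately show ?thesis by simp
    qed
  next
    case (insert j C)
    define x0 where "x0 = (\<lambda>(i, w). if j \<in> set w then 0 else x (i, w))"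
    define x1 where "x1 = (\<lambda>z. x z + (- 1) * x0 z)"
    have x0: "x0 \<in> W'" unfolding x0_def by (rule tensor_sub_avoiding[OF ac W' insert.prems(1)])
    have x1: "x1 \<in> W'" unfolding x1_def by (intro fun_subspaceD[OF sW'] insert.prems(1) x0)
    have "x0 \<in> W"
      by (rule insert.IH[OF x0, of A]) (use insert.prems(2) in \<open>auto simp: x0_def split: if_splits\<close>)
    moreover have "x1 \<in> W"
      by (rule insert.IH[OF x1, of "insert j A"])
        (use insert.prems(2) in \<open>auto simp: x0_def x1_def split: if_splits\<close>)
    ultimately have "(\<lambda>z. x0 z + x1 z) \<in> W" by (intro fun_subspaceD[OF sW])
    then show ?case by (simp add: x1_def)
  qed
  show ?thesis
  proof
    fix x assume x: "x \<in> W'"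
    have "finite (\<Union>(set ` snd ` {z. x z \<noteq> 0}))"
      using tensor_subD(2)[OF W' x] by (auto simp: fin_supp_def)
    then show "x \<in> W" by (rule *[OF _ x, of _ "{}"]) force
  qed
qed

section \<open>Presentations and finite length\<close>

definition presents ::
  "((nat \<Rightarrow> nat \<Rightarrow> 'k::field) \<Rightarrow> 'm::ab_group_add \<Rightarrow> 'm) \<Rightarrow> ((nat set \<Rightarrow> 'k) \<Rightarrow> 'm \<Rightarrow> 'm) \<Rightarrow>
    (nat \<Rightarrow> nat) \<Rightarrow> nat set \<Rightarrow> (nat \<times> nat list \<Rightarrow> 'k) set \<Rightarrow> ((nat \<times> nat list \<Rightarrow> 'k) \<Rightarrow> 'm) \<Rightarrow>
    'm set \<Rightarrow> bool" where
  "presents act rmul dg I N1 \<phi> U \<longleftrightarrow> tensor_sub dg I N1 \<and> \<phi> ` N1 = U \<and>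
     (\<forall>x\<in>N1. \<forall>y\<in>N1. \<phi> (\<lambda>z. x z + y z) = \<phi> x + \<phi> y) \<and>
     (\<forall>c. \<forall>x\<in>N1. \<phi> (\<lambda>z. c * x z) = rmul (Rscal c) (\<phi> x)) \<and>
     (\<forall>g\<in>GL. \<forall>x\<in>N1. \<phi> (tact g x) = act g (\<phi> x))"

lemma poly_rep_iff: "poly_rep act rmul U \<longleftrightarrow> (\<exists>dg N1 \<phi>. presents act rmul dg UNIV N1 \<phi> U)"
  unfolding poly_rep_def presents_def tensor_sub_def fun_subspace_def by (simp add: conj_ac)

lemma presentsD:
  assumes "presents act rmul dg I N1 \<phi> U"
  shows "tensor_sub dg I N1" "\<phi> ` N1 = U"
    "x \<in> N1 \<Longrightarrow> y \<in> N1 \<Longrightarrow> \<phi> (\<lambda>z. x z + y z) = \<phi> x + \<phi> y"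
    "x \<in> N1 \<Longrightarrow> \<phi> (\<lambda>z. c * x z) = rmul (Rscal c) (\<phi> x)"
    "g \<in> GL \<Longrightarrow> x \<in> N1 \<Longrightarrow> \<phi> (tact g x) = act g (\<phi> x)"
    "(\<lambda>z. 0) \<in> N1" "\<phi> (\<lambda>z. 0) = 0"
proof -
  show "tensor_sub dg I N1" "\<phi> ` N1 = U"
    "x \<in> N1 \<Longrightarrow> y \<in> N1 \<Longrightarrow> \<phi> (\<lambda>z. x z + y z) = \<phi> x + \<phi> y"
    "x \<in> N1 \<Longrightarrow> \<phi> (\<lambda>z. c * x z) = rmul (Rscal c) (\<phi> x)"
    "g \<in> GL \<Longrightarrow> x \<in> N1 \<Longrightarrow> \<phi> (tact g x) = act g (\<phi> x)"
    using assms unfolding presents_def by blast+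
  show zero: "(\<lambda>z. 0) \<in> N1"
    using assms fun_subspaceD(1) tensor_subD(1) unfolding presents_def by blast
  have "\<forall>x\<in>N1. \<forall>y\<in>N1. \<phi> (\<lambda>z. x z + y z) = \<phi> x + \<phi> y"
    using assms unfolding presents_def by blast
  from this[rule_format, OF zero zero] show "\<phi> (\<lambda>z. 0) = 0" by simp
qed

lemma gl_subD:
  assumes "gl_sub act rmul W"
  shows "0 \<in> W" "x \<in> W \<Longrightarrow> y \<in> W \<Longrightarrow> x + y \<in> W" "x \<in> W \<Longrightarrow> rmul (Rscal c) x \<in> W"
    "g \<in> GL \<Longrightarrow> x \<in> W \<Longrightarrow> act g x \<in> W"
  using assms unfolding gl_sub_def ksub_def by blast+

lemma gl_subI:
  assumes "0 \<in> W" "\<And>x y. x \<in> W \<Longrightarrow> y \<in> W \<Longrightarrow> x + y \<in> W"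
    "\<And>c x. x \<in> W \<Longrightarrow> rmul (Rscal c) x \<in> W" "\<And>g x. g \<in> GL \<Longrightarrow> x \<in> W \<Longrightarrow> act g x \<in> W"
  shows "gl_sub act rmul W"
  using assms unfolding gl_sub_def ksub_def by blast

lemma gl_sub_Int: "gl_sub act rmul V \<Longrightarrow> gl_sub act rmul W \<Longrightarrow> gl_sub act rmul (V \<inter> W)"
  by (rule gl_subI) (auto intro: gl_subD)

lemma tact_zero: "tact g (\<lambda>z. 0) = (\<lambda>z. 0)"
  by (auto simp: tact_def)

lemma tact_nonzeroD: "tact g x (i, w) \<noteq> 0 \<Longrightarrow> \<exists>v. x (i, v) \<noteq> 0"
  unfolding tact_def by (auto elim: sum.not_neutral_contains_not_neutral)

lemma presents_gl_sub:
  assumes "presents act rmul dg I N1 \<phi> U"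
  shows "gl_sub act rmul U"
proof -
  note D = presentsD[OF assms] and T = presentsD(1)[OF assms]
  note S = fun_subspaceD[OF tensor_subD(1)[OF T]]
  have U: "\<phi> x \<in> U" if "x \<in> N1" for x using that D(2) by blast
  show ?thesis
  proof (rule gl_subI)
    show "0 \<in> U" using U[OF D(6)] D(7) by simp
    show "x + y \<in> U" if "x \<in> U" "y \<in> U" for x y
      using that D(2) D(3)[symmetric] S(2) U by force
    show "rmul (Rscal c) x \<in> U" if "x \<in> U" for c x
      using that D(2) D(4)[symmetric] S(3) U by force
    show "act g x \<in> U" if "g \<in> GL" "x \<in> U" for g x
      using that D(2) D(5)[symmetric] tensor_subD(5)[OF T] U by force
  qed
qed

lemma presents_gl_sub_zero:
  assumes "presents act rmul dg I N1 \<phi> U"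
  shows "gl_sub act rmul {0}"
proof (rule gl_subI)
  note D = presentsD[OF assms]
  show "rmul (Rscal c) x \<in> {0}" if "x \<in> {0}" for c x
    using that D(4)[OF D(6), of c] D(7) by simp
  show "act g x \<in> {0}" if "g \<in> GL" "x \<in> {0}" for g x
    using that D(5)[OF _ D(6), of g] D(7) by (simp add: tact_zero)
qed auto

text \<open>One construction for both ways of shrinking a presentation: to elements mapped into
  \<open>W\<close> and to the summands in \<open>J\<close>. The latter is GL-stable because the
  action never mixes summands. The image may be smaller than \<open>W\<close>.\<close>

lemma presents_restrict:
  fixes J :: "nat set"
  assumes "presents act rmul dg I N1 \<phi> U" "gl_sub act rmul W"
  defines "N2 \<equiv> {x \<in> N1. \<phi> x \<in> W \<and> (\<forall>i w. x (i, w) \<noteq> 0 \<longrightarrow> i \<in> J)}"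
  shows "presents act rmul dg J N2 \<phi> (\<phi> ` N2)"
proof -
  note D = presentsD[OF assms(1)] and T = presentsD(1)[OF assms(1)]
  note S = fun_subspaceD[OF tensor_subD(1)[OF T]] and W = gl_subD[OF assms(2)]
  have "(\<lambda>z. x z + y z) \<in> N2" if "x \<in> N2" "y \<in> N2" for x y
  proof -
    have "i \<in> J" if "x (i, w) + y (i, w) \<noteq> 0" for i w
      using that \<open>x \<in> N2\<close> \<open>y \<in> N2\<close> by (cases "x (i, w) = 0") (auto simp: N2_def)
    then show ?thesis using that S(2) W(2) D(3) by (auto simp: N2_def)
  qed
  moreover have "(\<lambda>z. c * x z) \<in> N2" if "x \<in> N2" for c x
    using that S(3) W(3) D(4) by (auto simp: N2_def)
  moreover have "(\<lambda>z. 0) \<in> N2" using D W(1) by (auto simp: N2_def)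
  ultimately have "fun_subspace N2" unfolding fun_subspace_def by blast
  moreover have "tact g x \<in> N2" if "g \<in> GL" "x \<in> N2" for g x
    using that tensor_subD(5)[OF T] W(4) D(5) tact_nonzeroD[of g x] by (auto simp: N2_def)
  moreover have "N2 \<subseteq> TS dg" using T unfolding N2_def tensor_sub_def by blast
  moreover have "\<forall>x\<in>N2. \<forall>i w. x (i, w) \<noteq> 0 \<longrightarrow> i \<in> J" "N2 \<subseteq> N1" by (auto simp: N2_def)
  ultimately show ?thesis
    using assms(1) unfolding presents_def tensor_sub_def by blast
qed

text \<open>Lifts of the finitely many generators meet finitely many summands. What is supported
  there has a GL-stable image containing the generators, hence all of \<open>U\<close>.\<close>

lemma presents_finite_index:
  assumes pres: "presents act rmul dg I N1 \<phi> X" and U: "gl_sub act rmul U" "U \<subseteq> X"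
    and G: "finite G" "G \<subseteq> U" "\<forall>W. gl_sub act rmul W \<longrightarrow> G \<subseteq> W \<longrightarrow> U \<subseteq> W"
  shows "\<exists>J N2. finite J \<and> presents act rmul dg J N2 \<phi> U"
proof -
  note T = presentsD(1)[OF pres]
  have "\<forall>u\<in>G. \<exists>x\<in>N1. \<phi> x = u" using presentsD(2)[OF pres] U G by blast
  then obtain f where f: "\<And>u. u \<in> G \<Longrightarrow> f u \<in> N1 \<and> \<phi> (f u) = u" by metis
  define J where "J = (\<Union>u\<in>G. fst ` {z. f u z \<noteq> 0})"
  define N2 where "N2 = {x \<in> N1. \<phi> x \<in> U \<and> (\<forall>i w. x (i, w) \<noteq> 0 \<longrightarrow> i \<in> J)}"
  have "finite J" using G(1) f tensor_subD(2)[OF T] by (auto simp: J_def fin_supp_def)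
  have p: "presents act rmul dg J N2 \<phi> (\<phi> ` N2)"
    unfolding N2_def by (rule presents_restrict[OF pres U(1)])
  have "f u \<in> N2" if "u \<in> G" for u
    using that f G(2) unfolding N2_def J_def by force
  then have "G \<subseteq> \<phi> ` N2" using f by force
  then have "U \<subseteq> \<phi> ` N2" using G(3) presents_gl_sub[OF p] by blast
  moreover have "\<phi> ` N2 \<subseteq> U" by (auto simp: N2_def)
  ultimately show ?thesis using p \<open>finite J\<close> by (metis subset_antisym)
qed

text \<open>A proper subrepresentation of \<open>U\<close> with the greatest measure is maximal, so
  \<open>U\<close> can be appended to its composition series.\<close>

lemma finite_lengthI_measure:
  fixes \<mu> :: "'m::ab_group_add set \<Rightarrow> nat"
  assumes zero: "gl_sub act rmul {0}"
    and \<mu>: "\<And>V W. gl_sub act rmul V \<Longrightarrow> gl_sub act rmul W \<Longrightarrow> V \<subset> W \<Longrightarrow> W \<subseteq> X \<Longrightarrow> \<mu> V < \<mu> W"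
  shows "gl_sub act rmul U \<Longrightarrow> U \<subseteq> X \<Longrightarrow> finite_length act rmul U"
proof (induction "\<mu> U" arbitrary: U rule: less_induct)
  case less
  show ?case
  proof (cases "U = {0}")
    case True
    then show ?thesis unfolding finite_length_def
      by (intro exI[of _ "[{0}]"]) (simp add: zero)
  next
    case False
    let ?P = "\<lambda>V. gl_sub act rmul V \<and> V \<subset> U"
    have "?P {0}" using zero False gl_subD(1)[OF less.prems(1)] by auto
    moreover have "\<forall>V. ?P V \<longrightarrow> \<mu> V < Suc (\<mu> U)"
      using \<mu> less.prems by (metis less_SucI)
    ultimately obtain V where V: "?P V" "\<And>V'. ?P V' \<Longrightarrow> \<mu> V' \<le> \<mu> V"
      using ex_has_greatest_nat[of ?P "{0}" \<mu> "Suc (\<mu> U)"] by blast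
    have "finite_length act rmul V"
      using less.hyps[of V] V(1) \<mu>[of V U] less.prems by blast
    then obtain Us where Us: "Us \<noteq> []" "hd Us = {0}" "last Us = V"
      "\<forall>i<length Us. gl_sub act rmul (Us ! i)"
      "\<forall>i. Suc i < length Us \<longrightarrow> Us ! i \<subset> Us ! Suc i \<and>
          (\<forall>W. gl_sub act rmul W \<longrightarrow> Us ! i \<subseteq> W \<longrightarrow> W \<subseteq> Us ! Suc i \<longrightarrow>
               W = Us ! i \<or> W = Us ! Suc i)"
      unfolding finite_length_def by blast
    have top: "W = V \<or> W = U" if "gl_sub act rmul W" "V \<subseteq> W" "W \<subseteq> U" for W
    proof (rule ccontr)
      assume "\<not> ?thesis"
      then have "?P W" "V \<subset> W" using that by auto
      then show False using V \<mu>[of V W] less.prems(2) that by fastforce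
    qed
    show ?thesis unfolding finite_length_def
    proof (intro exI[of _ "Us @ [U]"] conjI)
      show "\<forall>i<length (Us @ [U]). gl_sub act rmul ((Us @ [U]) ! i)"
        using Us(4) less.prems(1) by (auto simp: nth_append)
      show "\<forall>i. Suc i < length (Us @ [U]) \<longrightarrow> (Us @ [U]) ! i \<subset> (Us @ [U]) ! Suc i \<and>
          (\<forall>W. gl_sub act rmul W \<longrightarrow> (Us @ [U]) ! i \<subseteq> W \<longrightarrow> W \<subseteq> (Us @ [U]) ! Suc i \<longrightarrow>
               W = (Us @ [U]) ! i \<or> W = (Us @ [U]) ! Suc i)"
      proof (intro allI impI)
        fix i assume i: "Suc i < length (Us @ [U])"
        show "(Us @ [U]) ! i \<subset> (Us @ [U]) ! Suc i \<and>
          (\<forall>W. gl_sub act rmul W \<longrightarrow> (Us @ [U]) ! i \<subseteq> W \<longrightarrow> W \<subseteq> (Us @ [U]) ! Suc i \<longrightarrow>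
               W = (Us @ [U]) ! i \<or> W = (Us @ [U]) ! Suc i)"
        proof (cases "Suc i < length Us")
          case True
          then show ?thesis using Us(5) by (simp add: nth_append)
        next
          case False
          then have "length Us = Suc i" using i by simp
          then have "(Us @ [U]) ! i = V" "(Us @ [U]) ! Suc i = U"
            using Us(1,3) by (auto simp: nth_append last_conv_nth)
          then show ?thesis using V(1) top by simp
        qed
      qed
    qed (use Us in auto)
  qed
qed

text \<open>Each layer of the series is simple, so a single element outside the lower term suffices
  to pass to the next one.\<close>

lemma finite_length_imp_finite_generators:
  assumes "finite_length act rmul U"
  shows "\<exists>G. finite G \<and> G \<subseteq> U \<and> (\<forall>W. gl_sub act rmul W \<longrightarrow> G \<subseteq> W \<longrightarrow> U \<subseteq> W)"
proof -
  obtain Us where Us: "Us \<noteq> []" "hd Us = {0}" "last Us = U"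
      "\<forall>i<length Us. gl_sub act rmul (Us ! i)"
      "\<forall>i. Suc i < length Us \<longrightarrow> Us ! i \<subset> Us ! Suc i \<and>
          (\<forall>W. gl_sub act rmul W \<longrightarrow> Us ! i \<subseteq> W \<longrightarrow> W \<subseteq> Us ! Suc i \<longrightarrow>
               W = Us ! i \<or> W = Us ! Suc i)"
    using assms unfolding finite_length_def by blast
  note Us_sub = Us(4)[rule_format] and Us_less = Us(5)[THEN spec, THEN mp, THEN conjunct1]
    and Us_simple = Us(5)[THEN spec, THEN mp, THEN conjunct2, rule_format]
  have "\<exists>G. finite G \<and> G \<subseteq> Us ! i \<and> (\<forall>W. gl_sub act rmul W \<longrightarrow> G \<subseteq> W \<longrightarrow> Us ! i \<subseteq> W)"
    if "i < length Us" for i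
    using that
  proof (induction i)
    case 0
    have "Us ! 0 = {0}" using Us(1,2) by (simp add: hd_conv_nth)
    then show ?case by (intro exI[of _ "{}"]) (auto dest: gl_subD(1))
  next
    case (Suc i)
    then obtain G where G: "finite G" "G \<subseteq> Us ! i"
      "\<forall>W. gl_sub act rmul W \<longrightarrow> G \<subseteq> W \<longrightarrow> Us ! i \<subseteq> W"
      using Suc.IH[OF Suc_lessD[OF Suc.prems]] by blast
    obtain x where x: "x \<in> Us ! Suc i" "x \<notin> Us ! i" using Us_less[OF Suc.prems] by blast
    have "Us ! Suc i \<subseteq> W" if W: "gl_sub act rmul W" "insert x G \<subseteq> W" for W
    proof -
      \<comment> \<open>The intersection lies between neighbouring terms and contains
        \<open>x\<close>, so it is the upper term.\<close>
      have "Us ! i \<subseteq> W \<inter> Us ! Suc i" using G(3) W Us_less[OF Suc.prems] by blast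
      then have "W \<inter> Us ! Suc i = Us ! i \<or> W \<inter> Us ! Suc i = Us ! Suc i"
        using Us_simple[OF Suc.prems, of "W \<inter> Us ! Suc i"] gl_sub_Int[OF W(1) Us_sub[OF Suc.prems]]
        by blast
      then show ?thesis using W x by blast
    qed
    then show ?case using G(1,2) x Us_less[OF Suc.prems] by (intro exI[of _ "insert x G"]) auto
  qed
  then show ?thesis using Us(1,3) by (metis diff_less last_conv_nth length_greater_0_conv zero_less_one)
qed

text \<open>The measure of \<open>W\<close> is the dimension, counted by leading words, of the part
  \<open>B W\<close> of its preimage \<open>K W\<close> supported on the finite set
  \<open>E\<close>. It is strict because \<open>B W\<close> determines \<open>K W\<close> and
  thereby \<open>W\<close>.\<close>

lemma presents_finite_length:
  fixes act :: "(nat \<Rightarrow> nat \<Rightarrow> 'k::field) \<Rightarrow> 'm::ab_group_add \<Rightarrow> 'm"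
  assumes ac: "alg_closed_field TYPE('k)"
    and pres: "presents act rmul dg I N1 \<phi> U" and I: "finite I"
  shows "finite_length act rmul U"
proof -
  define D where "D = Max (insert 0 (dg ` I))"
  have D: "dg i \<le> D" if "i \<in> I" for i using I that by (auto simp: D_def)
  define E where "E = (SIGMA i:I. {w. set w \<subseteq> {..<D} \<and> length w = dg i})"
  have finE: "finite E" using I by (auto simp: E_def intro: finite_lists_length_eq)
  define K where "K W = {x \<in> N1. \<phi> x \<in> W \<and> (\<forall>i w. x (i, w) \<noteq> 0 \<longrightarrow> i \<in> I)}" for W
  define B where "B W = {x \<in> K W. \<forall>i w. x (i, w) \<noteq> 0 \<longrightarrow> set w \<subseteq> {..<D}}" for W
  have K: "tensor_sub dg I (K W)" if "gl_sub act rmul W" for W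
    unfolding K_def using presentsD(1)[OF presents_restrict[OF pres that]] .
  have K_image: "\<phi> ` K W = W" if "W \<subseteq> U" for W
    using that presentsD(2)[OF pres] tensor_subD(3)[OF presentsD(1)[OF pres]]
    unfolding K_def by blast
  have B: "fun_subspace (B W)" if "gl_sub act rmul W" for W
  proof -
    note S = fun_subspaceD[OF tensor_subD(1)[OF K[OF that]]]
    have "(\<lambda>z. x z + y z) \<in> B W" if "x \<in> B W" "y \<in> B W" for x y
    proof -
      have "set w \<subseteq> {..<D}" if "x (i, w) + y (i, w) \<noteq> 0" for i w
        using that \<open>x \<in> B W\<close> \<open>y \<in> B W\<close> by (cases "x (i, w) = 0") (auto simp: B_def)
      then show ?thesis using that S(2) by (simp add: B_def)
    qed
    moreover have "(\<lambda>z. c * x z) \<in> B W" if "x \<in> B W" for c x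
      using that S(3) by (simp add: B_def) blast
    moreover have "(\<lambda>z. 0) \<in> B W" using S(1) by (simp add: B_def)
    ultimately show ?thesis unfolding fun_subspace_def by blast
  qed
  have supp: "z \<in> E" if "gl_sub act rmul W" "x \<in> B W" "x z \<noteq> 0" for W x z
  proof -
    have "x \<in> K W" using that(2) by (simp add: B_def)
    then show ?thesis
      using that(2,3) tensor_subD(3,4)[OF K[OF that(1)], of x "fst z" "snd z"]
      by (cases z) (auto simp: E_def B_def)
  qed
  define \<mu> where "\<mu> W = card (leads word_order (B W))" for W
  have "\<mu> V < \<mu> W" if VW: "gl_sub act rmul V" "gl_sub act rmul W" "V \<subset> W" "W \<subseteq> U" for V W
  proof (rule ccontr)
    assume "\<not> \<mu> V < \<mu> W"
    have sub: "B V \<subseteq> B W" using VW(3) by (auto simp: B_def K_def)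
    have lsub: "leads word_order (B V) \<subseteq> leads word_order (B W)"
      using sub by (auto simp: leads_def)
    have "leads word_order (B W) \<subseteq> E"
      using supp[OF VW(2)] by (auto simp: leads_def is_lead_def)
    then have "finite (leads word_order (B W))" using finE by (rule finite_subset)
    then have "leads word_order (B V) = leads word_order (B W)"
      using lsub \<open>\<not> \<mu> V < \<mu> W\<close> unfolding \<mu>_def by (metis psubsetI psubset_card_mono)
    then have "B V = B W"
      using subspace_eqI_leads[OF B[OF VW(1)] B[OF VW(2)] sub, of E word_order]
        supp[OF VW(2)] word_order total_on_subset[OF word_order(3)] tensor_subD(2)[OF K[OF VW(2)]]
      by (auto simp: B_def)
    then have "K W \<subseteq> K V"
      by (intro tensor_sub_determined[OF ac K[OF VW(1)] K[OF VW(2)] D]) (auto simp: B_def)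
    then have "W \<subseteq> V" using K_image VW by (metis image_mono less_imp_le order_trans)
    then show False using VW(3) by blast
  qed
  then show ?thesis
    using finite_lengthI_measure[OF presents_gl_sub_zero[OF pres], of U \<mu>] presents_gl_sub[OF pres]
    by blast
qed

section \<open>Generated subrepresentations and R-submodules\<close>

definition r_sub :: "((nat set \<Rightarrow> 'k::field) \<Rightarrow> 'm::ab_group_add \<Rightarrow> 'm) \<Rightarrow> 'm set \<Rightarrow> bool" where
  "r_sub rmul X \<longleftrightarrow> 0 \<in> X \<and> (\<forall>x\<in>X. \<forall>y\<in>X. x + y \<in> X) \<and> (\<forall>r\<in>Rel. \<forall>x\<in>X. rmul r x \<in> X)"

lemma r_subD:
  assumes "r_sub rmul X"
  shows "0 \<in> X" "x \<in> X \<Longrightarrow> y \<in> X \<Longrightarrow> x + y \<in> X" "r \<in> Rel \<Longrightarrow> x \<in> X \<Longrightarrow> rmul r x \<in> X"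
  using assms unfolding r_sub_def by blast+

definition gl_span :: "((nat \<Rightarrow> nat \<Rightarrow> 'k::field) \<Rightarrow> 'm \<Rightarrow> 'm) \<Rightarrow>
    ((nat set \<Rightarrow> 'k) \<Rightarrow> 'm::ab_group_add \<Rightarrow> 'm) \<Rightarrow> 'm set \<Rightarrow> 'm set" where
  "gl_span act rmul G = \<Inter>{W. G \<subseteq> W \<and> gl_sub act rmul W}"

lemma gl_span:
  "gl_sub act rmul (gl_span act rmul G)" "G \<subseteq> gl_span act rmul G"
  "gl_sub act rmul W \<Longrightarrow> G \<subseteq> W \<Longrightarrow> gl_span act rmul G \<subseteq> W"
  unfolding gl_span_def by (rule gl_subI) (auto dest: gl_subD)

definition r_span :: "((nat set \<Rightarrow> 'k::field) \<Rightarrow> 'm::ab_group_add \<Rightarrow> 'm) \<Rightarrow> 'm set \<Rightarrow> 'm set" where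
  "r_span rmul U = \<Inter>{X. U \<subseteq> X \<and> r_sub rmul X}"

lemma r_span:
  "r_sub rmul (r_span rmul U)" "U \<subseteq> r_span rmul U"
  "r_sub rmul X \<Longrightarrow> U \<subseteq> X \<Longrightarrow> r_span rmul U \<subseteq> X"
  unfolding r_span_def by (auto simp: r_sub_def)

section \<open>Graded modules over the exterior algebra\<close>

text \<open>Serves both \<open>M\<close> and its submodule \<open>N\<close>, the latter with the
  induced grading.\<close>

locale gl_module =
  fixes act :: "(nat \<Rightarrow> nat \<Rightarrow> 'k::field) \<Rightarrow> 'm::ab_group_add \<Rightarrow> 'm"
    and rmul :: "(nat set \<Rightarrow> 'k) \<Rightarrow> 'm \<Rightarrow> 'm"
    and gr :: "int \<Rightarrow> 'm set"
    and M :: "'m set"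
  assumes is_Rmod: "is_Rmod act rmul gr M"
begin

lemma module_axioms:
  shows zero_closed: "0 \<in> M"
    and add_closed: "x \<in> M \<Longrightarrow> y \<in> M \<Longrightarrow> x + y \<in> M"
    and rmul_closed: "r \<in> Rel \<Longrightarrow> x \<in> M \<Longrightarrow> rmul r x \<in> M"
    and rmul_add_left: "r \<in> Rel \<Longrightarrow> s \<in> Rel \<Longrightarrow> x \<in> M \<Longrightarrow>
      rmul (\<lambda>S. r S + s S) x = rmul r x + rmul s x"
    and rmul_add: "r \<in> Rel \<Longrightarrow> x \<in> M \<Longrightarrow> y \<in> M \<Longrightarrow> rmul r (x + y) = rmul r x + rmul r y"
    and rmul_rmul: "r \<in> Rel \<Longrightarrow> s \<in> Rel \<Longrightarrow> x \<in> M \<Longrightarrow> rmul (Rmul r s) x = rmul r (rmul s x)"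
    and rmul_one: "x \<in> M \<Longrightarrow> rmul (Rbasis {}) x = x"
    and act_closed: "g \<in> GL \<Longrightarrow> x \<in> M \<Longrightarrow> act g x \<in> M"
    and act_add: "g \<in> GL \<Longrightarrow> x \<in> M \<Longrightarrow> y \<in> M \<Longrightarrow> act g (x + y) = act g x + act g y"
    and act_rmul: "g \<in> GL \<Longrightarrow> r \<in> Rel \<Longrightarrow> x \<in> M \<Longrightarrow> act g (rmul r x) = rmul (ract g r) (act g x)"
  using is_Rmod unfolding is_Rmod_def by simp_all

lemma grading_axioms:
  shows gr_subset: "gr n \<subseteq> M" and gl_sub_gr: "gl_sub act rmul (gr n)"
    and ex1_homog_decomp: "x \<in> M \<Longrightarrow> \<exists>!c. homog_decomp gr x c"
    and poly_rep: "poly_rep act rmul M"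
  using is_Rmod unfolding is_Rmod_def by simp_all

lemma r_sub_carrier: "r_sub rmul M"
  using zero_closed add_closed rmul_closed by (simp add: r_sub_def)

lemma gl_sub_carrier: "gl_sub act rmul M"
  by (intro gl_subI zero_closed add_closed rmul_closed act_closed Rscal_in_Rel)

lemma rmul_zero: "r \<in> Rel \<Longrightarrow> rmul r 0 = 0"
  using rmul_add[of r 0 0] zero_closed by simp

lemma rmul_zero_left: "x \<in> M \<Longrightarrow> rmul (\<lambda>S. 0) x = 0"
  using rmul_add_left[of "\<lambda>S. 0" "\<lambda>S. 0" x] by (simp add: Rel_def fin_supp_def)

lemma act_zero: "g \<in> GL \<Longrightarrow> act g 0 = 0"
  using act_add[of g 0 0] zero_closed by simp

lemma rmul_scale_left:
  assumes "r \<in> Rel" "x \<in> M"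
  shows "rmul (\<lambda>S. c * r S) x = rmul (Rscal c) (rmul r x)"
    and "rmul (\<lambda>S. c * r S) x = rmul r (rmul (Rscal c) x)"
  using assms rmul_rmul[of "Rscal c" r x] rmul_rmul[of r "Rscal c" x]
  by (simp_all add: Rscal_in_Rel Rmul_Rscal_left Rmul_Rscal_right)

lemma sum_closed: "(\<And>a. a \<in> A \<Longrightarrow> f a \<in> M) \<Longrightarrow> sum f A \<in> M"
  by (induction A rule: infinite_finite_induct) (auto intro: zero_closed add_closed)

lemma rmul_sum: "r \<in> Rel \<Longrightarrow> (\<And>a. a \<in> A \<Longrightarrow> f a \<in> M) \<Longrightarrow> rmul r (sum f A) = (\<Sum>a\<in>A. rmul r (f a))"
  by (induction A rule: infinite_finite_induct) (auto simp: rmul_zero rmul_add sum_closed)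

lemma act_sum: "g \<in> GL \<Longrightarrow> (\<And>a. a \<in> A \<Longrightarrow> f a \<in> M) \<Longrightarrow> act g (sum f A) = (\<Sum>a\<in>A. act g (f a))"
  by (induction A rule: infinite_finite_induct) (auto simp: act_zero act_add sum_closed)

text \<open>Elements that \<open>g\<close> maps into the span form an R-submodule, because
  \<open>g\<close> moves past \<open>r\<close> at the price of replacing it by
  \<open>ract g r\<close>, again in R.\<close>

lemma act_r_span:
  assumes U: "U \<subseteq> M" "gl_sub act rmul U" and g: "g \<in> GL" and x: "x \<in> r_span rmul U"
  shows "act g x \<in> r_span rmul U"
proof -
  let ?S = "r_span rmul U"
  let ?Y = "{y \<in> M. act g y \<in> ?S}"
  note S = r_subD[OF r_span(1)[of rmul U]]
  have "r_sub rmul ?Y"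
    unfolding r_sub_def
    using S g ract_in_Rel[OF g]
    by (auto simp: act_zero act_add act_rmul zero_closed add_closed rmul_closed)
  moreover have "U \<subseteq> ?Y" using U(1) gl_subD(4)[OF U(2) g] r_span(2)[of U rmul] by blast
  ultimately show ?thesis using r_span(3) x by blast
qed

lemma homog_decomp_sum:
  assumes "homog_decomp gr x c" "finite A" "{n. c n \<noteq> 0} \<subseteq> A"
  shows "x = sum c A"
  using assms by (auto simp: homog_decomp_def intro!: sum.mono_neutral_left)

lemma homog_decompI:
  assumes "\<And>n. c n \<in> gr n" "finite A" "{n. c n \<noteq> 0} \<subseteq> A" "x = sum c A"
  shows "homog_decomp gr x c"
  using assms by (auto simp: homog_decomp_def intro: finite_subset sum.mono_neutral_right)

text \<open>Additivity is asked only for sums of components in \<open>M\<close>, as the actions are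
  controlled only on the carrier.\<close>

lemma homog_decomp_map:
  assumes x: "homog_decomp gr x c" and f: "\<And>n y. y \<in> gr n \<Longrightarrow> f y \<in> gr n" "f 0 = 0"
    "\<And>A. (\<And>n. n \<in> A \<Longrightarrow> c n \<in> M) \<Longrightarrow> f (sum c A) = (\<Sum>n\<in>A. f (c n))"
  shows "homog_decomp gr (f x) (\<lambda>n. f (c n))"
proof (rule homog_decompI)
  have c: "finite {n. c n \<noteq> 0}" "\<And>n. c n \<in> gr n" "x = sum c {n. c n \<noteq> 0}"
    using x by (auto simp: homog_decomp_def)
  show "f (c n) \<in> gr n" for n using c f by blast
  show "finite {n. c n \<noteq> 0}" by (rule c)
  show "{n. f (c n) \<noteq> 0} \<subseteq> {n. c n \<noteq> 0}" using f by auto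
  show "f x = (\<Sum>n | c n \<noteq> 0. f (c n))" using c f(3) gr_subset by (metis subsetD)
qed

lemma homog_decomp_add:
  assumes "homog_decomp gr x c" "homog_decomp gr y d"
  shows "homog_decomp gr (x + y) (\<lambda>n. c n + d n)"
proof (rule homog_decompI)
  let ?A = "{n. c n \<noteq> 0} \<union> {n. d n \<noteq> 0}"
  show "finite ?A" using assms by (auto simp: homog_decomp_def)
  have "x = sum c ?A" "y = sum d ?A"
    by (rule homog_decomp_sum[OF _ \<open>finite ?A\<close>], use assms in auto)+
  then show "x + y = (\<Sum>n\<in>?A. c n + d n)" unfolding sum.distrib by (rule arg_cong2)
  show "c n + d n \<in> gr n" for n
    using assms gl_subD(2)[OF gl_sub_gr] by (auto simp: homog_decomp_def)
qed auto

lemma homog_decomp_homogeneous: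
  assumes "x \<in> gr n"
  shows "homog_decomp gr x (\<lambda>m. if m = n then x else 0)"
  by (rule homog_decompI[of _ "{n}"])
    (use assms gl_subD(1)[OF gl_sub_gr] in auto)

text \<open>The elements having a decomposition with all components in the span form a GL-stable
  subspace containing \<open>G\<close>; uniqueness of decompositions does the rest.\<close>

lemma gl_span_graded:
  assumes G: "\<And>x. x \<in> G \<Longrightarrow> \<exists>n. x \<in> gr n" and x: "x \<in> gl_span act rmul G"
    and c: "homog_decomp gr x c"
  shows "c n \<in> gl_span act rmul G"
proof -
  let ?U = "gl_span act rmul G"
  note U = gl_subD[OF gl_span(1)[of act rmul G]]
  define Y where "Y = {x \<in> M. \<exists>c. homog_decomp gr x c \<and> (\<forall>n. c n \<in> ?U)}"
  have "gl_sub act rmul Y"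
  proof (rule gl_subI)
    have "homog_decomp gr 0 (\<lambda>n. 0)"
      by (rule homog_decompI[of _ "{}"]) (auto intro: gl_subD(1)[OF gl_sub_gr])
    then show "0 \<in> Y" using zero_closed U(1) by (auto simp: Y_def)
    show "x + y \<in> Y" if xy: "x \<in> Y" "y \<in> Y" for x y
    proof -
      obtain c d where "homog_decomp gr x c" "\<forall>n. c n \<in> ?U" "homog_decomp gr y d" "\<forall>n. d n \<in> ?U"
        using xy by (auto simp: Y_def)
      then have "homog_decomp gr (x + y) (\<lambda>n. c n + d n)" "\<forall>n. c n + d n \<in> ?U"
        using homog_decomp_add U(2) by auto
      then show ?thesis using xy add_closed by (auto simp: Y_def)
    qed
    show "rmul (Rscal a) x \<in> Y" if xY: "x \<in> Y" for a x
    proof -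
      obtain c where c: "homog_decomp gr x c" "\<forall>n. c n \<in> ?U" using xY by (auto simp: Y_def)
      have "homog_decomp gr (rmul (Rscal a) x) (\<lambda>n. rmul (Rscal a) (c n))"
        by (rule homog_decomp_map[OF c(1)])
          (auto intro: gl_subD(3)[OF gl_sub_gr] simp: rmul_zero rmul_sum Rscal_in_Rel)
      then show ?thesis using xY c(2) U(3) rmul_closed[OF Rscal_in_Rel] by (auto simp: Y_def)
    qed
    show "act g x \<in> Y" if g: "g \<in> GL" and xY: "x \<in> Y" for g x
    proof -
      obtain c where c: "homog_decomp gr x c" "\<forall>n. c n \<in> ?U" using xY by (auto simp: Y_def)
      have "homog_decomp gr (act g x) (\<lambda>n. act g (c n))"
        by (rule homog_decomp_map[OF c(1)])
          (auto intro: gl_subD(4)[OF gl_sub_gr g] simp: act_zero act_sum g)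
      then show ?thesis using xY c(2) U(4) act_closed g by (auto simp: Y_def)
    qed
  qed
  moreover have "G \<subseteq> Y"
  proof
    fix y assume y: "y \<in> G"
    then obtain n where n: "y \<in> gr n" using G by blast
    then have "homog_decomp gr y (\<lambda>m. if m = n then y else 0)" by (rule homog_decomp_homogeneous)
    moreover have "(if m = n then y else 0) \<in> ?U" for m
      using y gl_span(2)[of G act rmul] U(1) by auto
    ultimately show "y \<in> Y" using gr_subset n unfolding Y_def by blast
  qed
  ultimately have "x \<in> Y" using gl_span(3) x by blast
  then obtain d where "x \<in> M" "homog_decomp gr x d" "\<forall>n. d n \<in> ?U" by (auto simp: Y_def)
  then show ?thesis using ex1_homog_decomp c by metis
qed

end

text \<open>\<open>R \<otimes> N1\<close> is modelled by the functions on monomials all of whose slices \<open>F (S, _)\<close> lie in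
  \<open>N1\<close>, and \<open>multiply\<close> is the map \<open>R \<otimes> N1 \<rightarrow> M\<close>, \<open>r \<otimes> y \<mapsto> r \<phi>(y)\<close>.\<close>

locale presented_gl_module = gl_module act rmul gr M
  for act :: "(nat \<Rightarrow> nat \<Rightarrow> 'k::field) \<Rightarrow> 'm::ab_group_add \<Rightarrow> 'm"
    and rmul :: "(nat set \<Rightarrow> 'k) \<Rightarrow> 'm \<Rightarrow> 'm"
    and gr :: "int \<Rightarrow> 'm set"
    and M :: "'m set" +
  fixes dg :: "nat \<Rightarrow> nat" and I :: "nat set"
    and N1 :: "(nat \<times> nat list \<Rightarrow> 'k) set" and \<phi> :: "(nat \<times> nat list \<Rightarrow> 'k) \<Rightarrow> 'm" and U0 :: "'m set"
  assumes pres: "presents act rmul dg I N1 \<phi> U0"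
    and U0: "U0 \<subseteq> M" and generates: "M = r_span rmul U0"
begin

definition free_mod :: "(mono \<Rightarrow> 'k) set" where
  "free_mod = {F. fin_supp F \<and> (\<forall>S z. F (S, z) \<noteq> 0 \<longrightarrow> finite S) \<and> (\<forall>S. (\<lambda>z. F (S, z)) \<in> N1)}"

definition multiply :: "(mono \<Rightarrow> 'k) \<Rightarrow> 'm" where
  "multiply F = (\<Sum>S\<in>fst ` {z. F z \<noteq> 0}. rmul (Rbasis S) (\<phi> (\<lambda>z. F (S, z))))"

definition preimage :: "'m set \<Rightarrow> (mono \<Rightarrow> 'k) set" where
  "preimage X = {F \<in> free_mod. multiply F \<in> X}"

lemma free_modI:
  assumes "fin_supp F" "\<And>S z. F (S, z) \<noteq> 0 \<Longrightarrow> finite S" "\<And>S. (\<lambda>z. F (S, z)) \<in> N1"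
  shows "F \<in> free_mod"
  using assms unfolding free_mod_def by blast

lemma free_modD:
  assumes "F \<in> free_mod"
  shows "fin_supp F" "F (S, z) \<noteq> 0 \<Longrightarrow> finite S" "(\<lambda>z. F (S, z)) \<in> N1" "\<phi> (\<lambda>z. F (S, z)) \<in> M"
    "finite (fst ` {z. F z \<noteq> 0})" "S \<in> fst ` {z. F z \<noteq> 0} \<Longrightarrow> finite S"
proof -
  have fin: "F (S, z) \<noteq> 0 \<Longrightarrow> finite S" for S z
    using assms unfolding free_mod_def by blast
  then show "F (S, z) \<noteq> 0 \<Longrightarrow> finite S" .
  show "fin_supp F" and N1: "(\<lambda>z. F (S, z)) \<in> N1"
    using assms unfolding free_mod_def by blast+
  show "\<phi> (\<lambda>z. F (S, z)) \<in> M" using N1 presentsD(2)[OF pres] U0 by blast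
  show "finite (fst ` {z. F z \<noteq> 0})" "S \<in> fst ` {z. F z \<noteq> 0} \<Longrightarrow> finite S"
    using \<open>fin_supp F\<close> fin by (auto simp: fin_supp_def)
qed

text \<open>Lets the sums for several elements run over a common index set: missing slices are 0,
  and \<open>\<phi>\<close> maps 0 to 0.\<close>

lemma multiply_eq:
  assumes F: "F \<in> free_mod" and A: "finite A" "fst ` {z. F z \<noteq> 0} \<subseteq> A" "\<And>S. S \<in> A \<Longrightarrow> finite S"
  shows "multiply F = (\<Sum>S\<in>A. rmul (Rbasis S) (\<phi> (\<lambda>z. F (S, z))))"
  unfolding multiply_def
proof (rule sum.mono_neutral_left[OF A(1,2)], intro ballI)
  fix S assume S: "S \<in> A - fst ` {z. F z \<noteq> 0}"
  then have "F (S, z) = 0" for z by force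
  then show "rmul (Rbasis S) (\<phi> (\<lambda>z. F (S, z))) = 0"
    using presentsD(7)[OF pres] S A(3) by (simp add: rmul_zero Rbasis_in_Rel)
qed

lemma multiply_closed: "F \<in> free_mod \<Longrightarrow> multiply F \<in> M"
  unfolding multiply_def by (intro sum_closed rmul_closed Rbasis_in_Rel free_modD)

lemma free_mod_supp: "F \<in> free_mod \<Longrightarrow> F m \<noteq> 0 \<Longrightarrow> m \<in> monomials dg I"
  using tensor_subD(3,4)[OF presentsD(1)[OF pres] free_modD(3)[of F "fst m"],
      of "fst (snd m)" "snd (snd m)"] free_modD(2)[of F "fst m" "snd m"]
  by (cases m) (auto simp: monomials_def)

lemma free_mod_zero: "(\<lambda>m. 0) \<in> free_mod" "multiply (\<lambda>m. 0) = 0"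
  using presentsD(6)[OF pres] by (auto simp: free_mod_def fin_supp_def multiply_def)

lemma free_mod_add:
  assumes F: "F \<in> free_mod" and G: "G \<in> free_mod"
  shows "(\<lambda>m. F m + G m) \<in> free_mod" "multiply (\<lambda>m. F m + G m) = multiply F + multiply G"
proof -
  note S = fun_subspaceD[OF tensor_subD(1)[OF presentsD(1)[OF pres]]]
  have sub: "{m. F m + G m \<noteq> 0} \<subseteq> {m. F m \<noteq> 0} \<union> {m. G m \<noteq> 0}" by auto
  have "finite S" if "F (S, z) + G (S, z) \<noteq> 0" for S z
    using that free_modD(2)[OF F, of S z] free_modD(2)[OF G, of S z] by (cases "F (S, z) = 0") auto
  moreover have "fin_supp (\<lambda>m. F m + G m)"
    using free_modD(1)[OF F] free_modD(1)[OF G] finite_subset[OF sub] by (auto simp: fin_supp_def)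
  ultimately show FG: "(\<lambda>m. F m + G m) \<in> free_mod"
    by (intro free_modI S(2) free_modD(3)[OF F] free_modD(3)[OF G])
  let ?A = "fst ` ({m. F m \<noteq> 0} \<union> {m. G m \<noteq> 0})"
  have A: "finite ?A" "\<And>S. S \<in> ?A \<Longrightarrow> finite S"
    using free_modD(5,6)[OF F] free_modD(5,6)[OF G] by (auto simp: image_Un)
  have "multiply (\<lambda>m. F m + G m) = (\<Sum>S\<in>?A. rmul (Rbasis S) (\<phi> (\<lambda>z. F (S, z) + G (S, z))))"
    by (rule multiply_eq[OF FG A(1) _ A(2)]) (use sub in auto)
  also have "\<dots> = (\<Sum>S\<in>?A. rmul (Rbasis S) (\<phi> (\<lambda>z. F (S, z))) + rmul (Rbasis S) (\<phi> (\<lambda>z. G (S, z))))"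
    by (intro sum.cong refl)
      (simp add: A presentsD(3)[OF pres] free_modD(3,4) F G rmul_add Rbasis_in_Rel)
  also have "\<dots> = multiply F + multiply G"
    by (simp add: sum.distrib multiply_eq[OF F A(1) _ A(2)] multiply_eq[OF G A(1) _ A(2)] image_mono)
  finally show "multiply (\<lambda>m. F m + G m) = multiply F + multiply G" .
qed

lemma free_mod_scale:
  assumes F: "F \<in> free_mod"
  shows "(\<lambda>m. c * F m) \<in> free_mod" "multiply (\<lambda>m. c * F m) = rmul (Rscal c) (multiply F)"
proof -
  note S = fun_subspaceD[OF tensor_subD(1)[OF presentsD(1)[OF pres]]]
  let ?A = "fst ` {m. F m \<noteq> 0}"
  have "{m. c * F m \<noteq> 0} \<subseteq> {m. F m \<noteq> 0}" by auto
  then have "fin_supp (\<lambda>m. c * F m)"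
    using free_modD(1)[OF F] by (auto simp: fin_supp_def intro: finite_subset)
  then show cF: "(\<lambda>m. c * F m) \<in> free_mod"
    by (rule free_modI) (auto intro: S(3) free_modD(2,3)[OF F])
  have "multiply (\<lambda>m. c * F m) = (\<Sum>S\<in>?A. rmul (Rbasis S) (\<phi> (\<lambda>z. c * F (S, z))))"
    by (rule multiply_eq[OF cF]) (use free_modD(5,6)[OF F] in auto)
  also have "\<dots> = (\<Sum>S\<in>?A. rmul (Rscal c) (rmul (Rbasis S) (\<phi> (\<lambda>z. F (S, z)))))"
    using free_modD[OF F] rmul_scale_left[OF Rbasis_in_Rel]
    by (intro sum.cong refl) (simp add: presentsD(4)[OF pres])
  also have "\<dots> = rmul (Rscal c) (multiply F)"
    unfolding multiply_def
    by (rule rmul_sum[symmetric]) (auto intro: Rscal_in_Rel rmul_closed Rbasis_in_Rel free_modD[OF F])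
  finally show "multiply (\<lambda>m. c * F m) = rmul (Rscal c) (multiply F)" .
qed

text \<open>Left multiplication by e_T in coordinates: the coefficient at \<open>Q\<close> can only
  come from the set \<open>Q - T\<close>.\<close>

definition wedge :: "nat set \<Rightarrow> (mono \<Rightarrow> 'k) \<Rightarrow> mono \<Rightarrow> 'k" where
  "wedge T F = (\<lambda>(Q, z). if T \<subseteq> Q then wsign T (Q - T) * F (Q - T, z) else 0)"

lemma wedge_nonzeroD:
  "wedge T F (Q, z) \<noteq> 0 \<Longrightarrow> \<exists>S. Q = T \<union> S \<and> T \<inter> S = {} \<and> F (S, z) \<noteq> 0"
  by (rule exI[of _ "Q - T"]) (auto simp: wedge_def split: if_splits)

lemma wedge:
  assumes F: "F \<in> free_mod" and T: "finite T"
  shows "wedge T F \<in> free_mod" "multiply (wedge T F) = rmul (Rbasis T) (multiply F)"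
proof -
  note S = fun_subspaceD[OF tensor_subD(1)[OF presentsD(1)[OF pres]]]
  have "(\<lambda>z. wedge T F (Q, z)) \<in> N1" for Q
    using S(1) S(3)[OF free_modD(3)[OF F]] by (cases "T \<subseteq> Q") (auto simp: wedge_def)
  moreover have "finite Q" if "wedge T F (Q, z) \<noteq> 0" for Q z
    using that free_modD(2)[OF F, of "Q - T" z] T by (auto simp: wedge_def split: if_splits)
  moreover have "fin_supp (wedge T F)"
  proof -
    have "m \<in> (\<lambda>(S, z). (T \<union> S, z)) ` {m. F m \<noteq> 0}" if "wedge T F m \<noteq> 0" for m
      using that wedge_nonzeroD[of T F "fst m" "snd m"] by (cases m) force
    then have "{m. wedge T F m \<noteq> 0} \<subseteq> (\<lambda>(S, z). (T \<union> S, z)) ` {m. F m \<noteq> 0}" by blast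
    then show ?thesis
      using free_modD(1)[OF F] unfolding fin_supp_def by (meson finite_imageI finite_subset)
  qed
  ultimately show wF: "wedge T F \<in> free_mod" by (intro free_modI)
  let ?A = "fst ` {m. F m \<noteq> 0}"
  let ?D = "{S \<in> ?A. T \<inter> S = {}}"
  have fin: "finite S" if "S \<in> ?A" for S using that free_modD(6)[OF F] by blast
  \<comment> \<open>The sign is moved inside as a scalar so that \<open>\<phi>\<close> can absorb
    it.\<close>
  have basis_mult: "rmul (Rbasis T) (rmul (Rbasis S) x) =
      (if T \<inter> S = {} then rmul (Rbasis (T \<union> S)) (rmul (Rscal (wsign T S)) x) else 0)"
    if "finite S" "x \<in> M" for S x
  proof -
    have "rmul (Rbasis T) (rmul (Rbasis S) x) = rmul (Rmul (Rbasis T) (Rbasis S)) x"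
      using rmul_rmul T that Rbasis_in_Rel by metis
    moreover have "Rmul (Rbasis T) (Rbasis S) = (\<lambda>U. wsign T S * (Rbasis (T \<union> S) U :: 'k))"
      if "T \<inter> S = {}"
      unfolding Rmul_Rbasis using that by (auto simp: Rbasis_def)
    moreover have "Rmul (Rbasis T) (Rbasis S) = (\<lambda>U. 0 :: 'k)" if "T \<inter> S \<noteq> {}"
      using that by (auto simp: Rmul_Rbasis)
    ultimately show ?thesis
      using that T rmul_scale_left(2)[OF Rbasis_in_Rel, of "T \<union> S" x] rmul_zero_left by simp
  qed
  have "multiply (wedge T F) =
    (\<Sum>Q\<in>(\<lambda>S. T \<union> S) ` ?D. rmul (Rbasis Q) (\<phi> (\<lambda>z. wedge T F (Q, z))))"
  proof (rule multiply_eq[OF wF])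
    show "finite ((\<lambda>S. T \<union> S) ` ?D)" using free_modD(5)[OF F] by simp
    show "fst ` {m. wedge T F m \<noteq> 0} \<subseteq> (\<lambda>S. T \<union> S) ` ?D"
    proof
      fix Q assume "Q \<in> fst ` {m. wedge T F m \<noteq> 0}"
      then obtain z where z: "wedge T F (Q, z) \<noteq> 0" by force
      obtain S where S: "Q = T \<union> S" "T \<inter> S = {}" "F (S, z) \<noteq> 0"
        using wedge_nonzeroD[OF z] by (elim exE conjE)
      then have "S \<in> ?D" using image_eqI[of S fst "(S, z)"] by simp
      then show "Q \<in> (\<lambda>S. T \<union> S) ` ?D" using S(1) by blast
    qed
  qed (use T fin in auto)
  also have "\<dots> = (\<Sum>S\<in>?D. rmul (Rbasis (T \<union> S)) (\<phi> (\<lambda>z. wedge T F (T \<union> S, z))))"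
    by (rule sum.reindex_cong[of "\<lambda>S. T \<union> S"]) (auto simp: inj_on_def)
  also have "\<dots> = (\<Sum>S\<in>?D. rmul (Rbasis T) (rmul (Rbasis S) (\<phi> (\<lambda>z. F (S, z)))))"
  proof (rule sum.cong)
    fix S assume S: "S \<in> ?D"
    then have "(\<lambda>z. wedge T F (T \<union> S, z)) = (\<lambda>z. wsign T S * F (S, z))"
      by (auto simp: wedge_def Un_Diff Diff_triv Int_commute)
    then show "rmul (Rbasis (T \<union> S)) (\<phi> (\<lambda>z. wedge T F (T \<union> S, z))) =
        rmul (Rbasis T) (rmul (Rbasis S) (\<phi> (\<lambda>z. F (S, z))))"
      using S fin basis_mult free_modD(3,4)[OF F] presentsD(4)[OF pres] by simp
  qed simp
  \<comment> \<open>Sets meeting \<open>T\<close> contribute 0 and may be put back.\<close>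
  also have "\<dots> = (\<Sum>S\<in>?A. rmul (Rbasis T) (rmul (Rbasis S) (\<phi> (\<lambda>z. F (S, z)))))"
    by (rule sum.mono_neutral_left) (use free_modD(4,5)[OF F] fin basis_mult in auto)
  also have "\<dots> = rmul (Rbasis T) (multiply F)"
    unfolding multiply_def
    by (rule rmul_sum[symmetric]) (auto intro: rmul_closed Rbasis_in_Rel free_modD[OF F] T)
  finally show "multiply (wedge T F) = rmul (Rbasis T) (multiply F)" .
qed

text \<open>No reordering sign is included, so this is the action of the permutation matrix provided
  \<open>\<pi>\<close> is increasing on every set that occurs in \<open>F\<close>.\<close>

definition permute :: "(nat \<Rightarrow> nat) \<Rightarrow> (mono \<Rightarrow> 'k) \<Rightarrow> mono \<Rightarrow> 'k" where
  "permute \<pi> F = (\<lambda>(Q, i, v). F (inv \<pi> ` Q, i, map (inv \<pi>) v))"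

lemma permute_nonzeroD:
  assumes "bij \<pi>" "permute \<pi> F (Q, i, v) \<noteq> 0"
  shows "\<exists>S w. Q = \<pi> ` S \<and> v = map \<pi> w \<and> F (S, i, w) \<noteq> 0"
proof (intro exI conjI)
  have "\<pi> \<circ> inv \<pi> = id" using assms(1) by (simp add: bij_is_surj flip: surj_iff)
  then show "Q = \<pi> ` inv \<pi> ` Q" "v = map \<pi> (map (inv \<pi>) v)"
    by (simp_all add: image_comp del: o_apply)
qed (use assms(2) in \<open>simp add: permute_def\<close>)

lemma permute:
  assumes F: "F \<in> free_mod" and \<pi>: "\<pi> permutes {..<n}"
    and mono: "\<And>S z. F (S, z) \<noteq> 0 \<Longrightarrow> strict_mono_on S \<pi>"
  shows "permute \<pi> F \<in> free_mod" "multiply (permute \<pi> F) = act (perm_mat \<pi>) (multiply F)"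
proof -
  note T = presentsD(1)[OF pres]
  have bij: "bij \<pi>" using \<pi> by (rule permutes_bij)
  have g: "perm_mat \<pi> \<in> GL" using \<pi> by (rule perm_mat_GL)
  have inv_image: "inv \<pi> ` \<pi> ` S = S" for S using bij by (simp add: bij_is_inj image_inv_f_f)
  have slice: "(\<lambda>z. permute \<pi> F (Q, z)) = tact (perm_mat \<pi>) (\<lambda>z. F (inv \<pi> ` Q, z))" for Q
    using tact_perm_mat[OF bij tensor_subD(2)[OF T free_modD(3)[OF F]]]
    by (auto simp: permute_def)
  have "(\<lambda>z. permute \<pi> F (Q, z)) \<in> N1" for Q
    unfolding slice by (rule tensor_subD(5)[OF T g free_modD(3)[OF F]])
  moreover have "finite Q" if "permute \<pi> F (Q, z) \<noteq> 0" for Q z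
    using that permute_nonzeroD[OF bij, of F Q "fst z" "snd z"] free_modD(2)[OF F] by auto
  moreover have "fin_supp (permute \<pi> F)"
  proof -
    have "m \<in> (\<lambda>(S, i, w). (\<pi> ` S, i, map \<pi> w)) ` {m. F m \<noteq> 0}" if "permute \<pi> F m \<noteq> 0" for m
      using that permute_nonzeroD[OF bij, of F "fst m" "fst (snd m)" "snd (snd m)"]
      by (cases m) force
    then have "{m. permute \<pi> F m \<noteq> 0} \<subseteq> (\<lambda>(S, i, w). (\<pi> ` S, i, map \<pi> w)) ` {m. F m \<noteq> 0}"
      by blast
    then show ?thesis
      using free_modD(1)[OF F] unfolding fin_supp_def by (meson finite_imageI finite_subset)
  qed
  ultimately show pF: "permute \<pi> F \<in> free_mod" by (intro free_modI)
  let ?A = "fst ` {m. F m \<noteq> 0}"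
  have fin: "finite S" if "S \<in> ?A" for S using that free_modD(6)[OF F] by blast
  have "multiply (permute \<pi> F) =
    (\<Sum>Q\<in>(`) \<pi> ` ?A. rmul (Rbasis Q) (\<phi> (\<lambda>z. permute \<pi> F (Q, z))))"
  proof (rule multiply_eq[OF pF])
    show "fst ` {m. permute \<pi> F m \<noteq> 0} \<subseteq> (`) \<pi> ` ?A"
    proof
      fix Q assume "Q \<in> fst ` {m. permute \<pi> F m \<noteq> 0}"
      then obtain i v where iv: "permute \<pi> F (Q, i, v) \<noteq> 0" by force
      obtain S w where S: "Q = \<pi> ` S" "F (S, i, w) \<noteq> 0"
        using permute_nonzeroD[OF bij iv] by (elim exE conjE)
      then have "S \<in> ?A" using image_eqI[of S fst "(S, i, w)"] by simp
      then show "Q \<in> (`) \<pi> ` ?A" using S(1) by blast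
    qed
  qed (use free_modD(5)[OF F] fin in auto)
  also have "\<dots> = (\<Sum>S\<in>?A. rmul (Rbasis (\<pi> ` S)) (\<phi> (\<lambda>z. permute \<pi> F (\<pi> ` S, z))))"
    by (rule sum.reindex_cong[of "(`) \<pi>"]) (auto simp: inj_on_def inj_image_eq_iff[OF bij_is_inj[OF bij]])
  also have "\<dots> = (\<Sum>S\<in>?A. act (perm_mat \<pi>) (rmul (Rbasis S) (\<phi> (\<lambda>z. F (S, z)))))"
  proof (rule sum.cong)
    fix S assume S: "S \<in> ?A"
    then have "strict_mono_on S \<pi>" using mono by force
    then show "rmul (Rbasis (\<pi> ` S)) (\<phi> (\<lambda>z. permute \<pi> F (\<pi> ` S, z))) =
        act (perm_mat \<pi>) (rmul (Rbasis S) (\<phi> (\<lambda>z. F (S, z))))"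
      using act_rmul[OF g Rbasis_in_Rel[OF fin[OF S]] free_modD(4)[OF F]]
        presentsD(5)[OF pres g free_modD(3)[OF F]]
      by (simp add: slice inv_image ract_perm_mat[OF bij fin[OF S]])
  qed simp
  also have "\<dots> = act (perm_mat \<pi>) (multiply F)"
    unfolding multiply_def
    by (rule act_sum[symmetric, OF g]) (auto intro: rmul_closed Rbasis_in_Rel free_modD[OF F])
  finally show "multiply (permute \<pi> F) = act (perm_mat \<pi>) (multiply F)" .
qed

end

section \<open>Noetherianity\<close>

text \<open>Elements of R are finite combinations of the e_S, so one peels off one set of the
  support at a time.\<close>

lemma (in gl_module) r_subI_basis:
  assumes X: "X \<subseteq> M" "0 \<in> X" "\<And>x y. x \<in> X \<Longrightarrow> y \<in> X \<Longrightarrow> x + y \<in> X"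
    and basis: "\<And>S x. finite S \<Longrightarrow> x \<in> X \<Longrightarrow> rmul (Rbasis S) x \<in> X"
    and scal: "\<And>c x. x \<in> X \<Longrightarrow> rmul (Rscal c) x \<in> X"
  shows "r_sub rmul X"
proof -
  have *: "\<forall>r\<in>Rel. {S. r S \<noteq> 0} \<subseteq> A \<longrightarrow> rmul r x \<in> X" if "finite A" "x \<in> X" for A x
    using that(1)
  proof (induction A rule: finite_induct)
    case empty
    show ?case
    proof (intro ballI impI)
      fix r :: "nat set \<Rightarrow> 'k" assume "{S. r S \<noteq> 0} \<subseteq> {}"
      then have "r = (\<lambda>S. 0)" by auto
      moreover have "rmul (\<lambda>S. 0) x = 0" using X(1) \<open>x \<in> X\<close> by (intro rmul_zero_left) auto
      ultimately show "rmul r x \<in> X" using X(2) by simp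
    qed
  next
    case (insert S A)
    show ?case
    proof (intro ballI impI)
      fix r :: "nat set \<Rightarrow> 'k" assume r: "r \<in> Rel" "{S. r S \<noteq> 0} \<subseteq> insert S A"
      show "rmul r x \<in> X"
      proof (cases "r S = 0")
        case True
        then show ?thesis using insert.IH r by blast
      next
        case False
        then have S: "finite S" using r(1) by (simp add: Rel_def)
        define r0 where "r0 = r(S := 0)"
        let ?rS = "\<lambda>U. r S * Rbasis S U"
        have "{U. r0 U \<noteq> 0} \<subseteq> {U. r U \<noteq> 0}" by (auto simp: r0_def)
        then have r0: "r0 \<in> Rel" using r(1) by (auto simp: Rel_def fin_supp_def intro: finite_subset)
        have "{U. ?rS U \<noteq> 0} \<subseteq> {S}" by (auto simp: Rbasis_def)
        then have rS: "?rS \<in> Rel"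
          using S by (auto simp: Rel_def fin_supp_def intro: finite_subset)
        have "{U. r0 U \<noteq> 0} \<subseteq> A" using r(2) by (auto simp: r0_def)
        then have "rmul r0 x \<in> X" using insert.IH r0 by blast
        moreover have "rmul ?rS x \<in> X"
          using rmul_scale_left(1)[OF Rbasis_in_Rel[OF S]] X(1) \<open>x \<in> X\<close> basis[OF S] scal by auto
        ultimately have "rmul (\<lambda>U. ?rS U + r0 U) x \<in> X"
          using rmul_add_left[OF rS r0] X \<open>x \<in> X\<close> by auto
        moreover have "(\<lambda>U. ?rS U + r0 U) = r" by (auto simp: r0_def Rbasis_def)
        ultimately show ?thesis by simp
      qed
    qed
  qed
  have "rmul r x \<in> X" if "r \<in> Rel" "x \<in> X" for r x
    using *[of "{S. r S \<noteq> 0}" x] that by (auto simp: Rel_def fin_supp_def)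
  then show ?thesis using X by (auto simp: r_sub_def)
qed

section \<open>Leading monomials of submodules and finite generation\<close>

context presented_gl_module
begin

lemma multiply_surj: "multiply ` free_mod = M"
proof
  show "multiply ` free_mod \<subseteq> M" using multiply_closed by blast
  have "r_sub rmul (multiply ` free_mod)"
  proof (rule r_subI_basis)
    show "0 \<in> multiply ` free_mod" using free_mod_zero by force
    show "x + y \<in> multiply ` free_mod" if "x \<in> multiply ` free_mod" "y \<in> multiply ` free_mod" for x y
      using that free_mod_add(1) by (auto simp flip: free_mod_add(2))
    show "rmul (Rbasis S) x \<in> multiply ` free_mod"
      if "finite S" "x \<in> multiply ` free_mod" for S x
      using that wedge(1) by (auto simp flip: wedge(2))
    show "rmul (Rscal c) x \<in> multiply ` free_mod" if "x \<in> multiply ` free_mod" for c x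
      using that free_mod_scale(1) by (auto simp flip: free_mod_scale(2))
  qed (use multiply_closed in blast)
  moreover have "U0 \<subseteq> multiply ` free_mod"
  proof
    fix u assume "u \<in> U0"
    then obtain y where y: "y \<in> N1" "\<phi> y = u" using presentsD(2)[OF pres] by blast
    \<comment> \<open>This is \<open>1 \<otimes> y\<close>.\<close>
    define F :: "mono \<Rightarrow> 'k" where "F = (\<lambda>(S, z). if S = {} then y z else 0)"
    have supp: "{m. F m \<noteq> 0} \<subseteq> Pair {} ` {z. y z \<noteq> 0}"
      by (auto simp: F_def split: if_splits)
    have "F \<in> free_mod"
    proof (rule free_modI)
      show "fin_supp F"
        using finite_subset[OF supp] tensor_subD(2)[OF presentsD(1)[OF pres] y(1)]
        by (simp add: fin_supp_def)
      show "(\<lambda>z. F (S, z)) \<in> N1" for S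
        using y(1) presentsD(6)[OF pres] by (cases "S = {}") (auto simp: F_def)
    qed (auto simp: F_def split: if_splits)
    moreover have "multiply F = (\<Sum>S\<in>{{}}. rmul (Rbasis S) (\<phi> (\<lambda>z. F (S, z))))"
      by (rule multiply_eq[OF \<open>F \<in> free_mod\<close>]) (use supp in auto)
    then have "multiply F = u"
      using y(2) \<open>u \<in> U0\<close> U0 rmul_one by (auto simp: F_def)
    ultimately show "u \<in> multiply ` free_mod" by blast
  qed
  ultimately show "M \<subseteq> multiply ` free_mod" using r_span(3) generates by blast
qed

lemma fun_subspace_preimage:
  assumes "r_sub rmul X"
  shows "fun_subspace (preimage X)"
  unfolding fun_subspace_def preimage_def
  using free_mod_zero free_mod_add free_mod_scale
    r_subD(1,2)[OF assms] r_subD(3)[OF assms Rscal_in_Rel] by simp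

text \<open>Disjointness keeps the leading term alive; each other term either dies or is enlarged by
  the same \<open>T\<close>, which preserves its place below the lead.\<close>

lemma leads_wedge:
  assumes X: "r_sub rmul X" and m: "(S, i, w) \<in> leads mono_order (preimage X)"
    and T: "finite T" "T \<inter> S = {}"
  shows "(T \<union> S, i, w) \<in> leads mono_order (preimage X)"
proof -
  obtain F where F: "F \<in> free_mod" "multiply F \<in> X" "is_lead mono_order F (S, i, w)"
    using m by (auto simp: leads_def preimage_def)
  have S: "F (S, i, w) \<noteq> 0" "finite S" using F free_modD(2) by (auto simp: is_lead_def)
  have "wedge T F \<in> preimage X"
    using wedge[OF F(1) T(1)] r_subD(3)[OF X Rbasis_in_Rel[OF T(1)] F(2)] by (simp add: preimage_def)
  moreover have "is_lead mono_order (wedge T F) (T \<union> S, i, w)"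
    unfolding is_lead_def
  proof (intro conjI allI impI)
    have "T \<union> S - T = S" using T by blast
    then show "wedge T F (T \<union> S, i, w) \<noteq> 0" using S by (simp add: wedge_def wsign_def)
    fix m' assume "wedge T F m' \<noteq> 0"
    then obtain S' i' w' where m': "m' = (T \<union> S', i', w')" "F (S', i', w') \<noteq> 0" "T \<inter> S' = {}"
      using wedge_nonzeroD[of T F "fst m'" "snd m'"] by (cases m') auto
    then have "(S', i', w') = (S, i, w) \<or> ((S', i', w'), (S, i, w)) \<in> mono_order"
      using F(3) by (simp add: is_lead_def)
    then show "m' = (T \<union> S, i, w) \<or> (m', (T \<union> S, i, w)) \<in> mono_order"
      using mono_order_union[of S' i' w' S i w T] m' T S free_modD(2)[OF F(1) m'(2)] by auto
  qed
  ultimately show ?thesis by (auto simp: leads_def)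
qed

text \<open>\<open>\<sigma>\<close> is replaced by a permutation that agrees with it on the finite
  set of indices occurring in \<open>F\<close>.\<close>

lemma leads_shift:
  assumes X: "\<And>g x. g \<in> GL \<Longrightarrow> x \<in> X \<Longrightarrow> act g x \<in> X"
    and m: "(S, i, w) \<in> leads mono_order (preimage X)" and \<sigma>: "strict_mono \<sigma>"
  shows "(\<sigma> ` S, i, map \<sigma> w) \<in> leads mono_order (preimage X)"
proof -
  obtain F where F: "F \<in> free_mod" "multiply F \<in> X" "is_lead mono_order F (S, i, w)"
    using m by (auto simp: leads_def preimage_def)
  \<comment> \<open>Indices of all terms are collected, not just of the leading one, since every
    comparison with the lead must survive.\<close>
  define U where "U = (\<Union>(S, i, w)\<in>{m. F m \<noteq> 0}. S \<union> set w)"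
  have U: "S' \<union> set w' \<subseteq> U" if "F (S', i', w') \<noteq> 0" for S' i' w'
    using that unfolding U_def by blast
  have "finite U"
    using free_modD(1,2)[OF F(1)] by (auto simp: U_def fin_supp_def)
  moreover have "inj_on \<sigma> U" using \<sigma> strict_mono_imp_inj_on by (metis inj_on_subset subset_UNIV)
  ultimately obtain \<pi> n where \<pi>: "\<pi> permutes {..<n}" "\<And>x. x \<in> U \<Longrightarrow> \<pi> x = \<sigma> x"
    using ex_permutes_extending by metis
  have mono: "strict_mono_on U \<pi>" using \<pi>(2) \<sigma> by (auto simp: strict_mono_on_def strict_mono_def)
  then have mono_sub: "strict_mono_on A \<pi>" if "A \<subseteq> U" for A
    using that unfolding strict_mono_on_def by blast
  have bij: "bij \<pi>" using \<pi>(1) by (rule permutes_bij)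
  have lead: "F (S, i, w) \<noteq> 0" "finite S" using F free_modD(2) by (auto simp: is_lead_def)
  have "\<sigma> x = \<pi> x" if "x \<in> S \<union> set w" for x using that U[OF lead(1)] \<pi>(2)[of x] by auto
  then have agree: "\<sigma> ` S = \<pi> ` S" "map \<sigma> w = map \<pi> w" by (auto intro!: image_cong)
  have mono_slice: "strict_mono_on S' \<pi>" if "F (S', z) \<noteq> 0" for S' z
    using U[of S' "fst z" "snd z"] that by (intro mono_sub) auto
  have "permute \<pi> F \<in> preimage X"
    using permute[OF F(1) \<pi>(1) mono_slice] X[OF perm_mat_GL[OF \<pi>(1)] F(2)] by (simp add: preimage_def)
  moreover have "is_lead mono_order (permute \<pi> F) (\<pi> ` S, i, map \<pi> w)"
    unfolding is_lead_def
  proof (intro conjI allI impI)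
    show "permute \<pi> F (\<pi> ` S, i, map \<pi> w) \<noteq> 0"
      using lead(1) bij by (simp add: permute_def image_inv_f_f bij_is_inj o_def)
    fix m' assume "permute \<pi> F m' \<noteq> 0"
    then obtain S' i' w' where m': "m' = (\<pi> ` S', i', map \<pi> w')" "F (S', i', w') \<noteq> 0"
      using permute_nonzeroD[OF bij, of F "fst m'" "fst (snd m')" "snd (snd m')"] by (cases m') auto
    then have "(S', i', w') = (S, i, w) \<or> ((S', i', w'), (S, i, w)) \<in> mono_order"
      using F(3) by (simp add: is_lead_def)
    moreover have "strict_mono_on (S' \<union> S \<union> set w' \<union> set w) \<pi>"
      using U[OF m'(2)] U[OF lead(1)] by (intro mono_sub) auto
    ultimately show "m' = (\<pi> ` S, i, map \<pi> w) \<or> (m', (\<pi> ` S, i, map \<pi> w)) \<in> mono_order"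
      using mono_order_map[of S' i' w' S i w \<pi>] m' lead free_modD(2)[OF F(1) m'(2)] by auto
  qed
  ultimately show ?thesis unfolding agree by (auto simp: leads_def)
qed

lemma leads_upward_closed:
  assumes X: "r_sub rmul X" "\<And>g x. g \<in> GL \<Longrightarrow> x \<in> X \<Longrightarrow> act g x \<in> X"
    and m: "m \<in> leads mono_order (preimage X)" "mono_le m m'"
  shows "m' \<in> leads mono_order (preimage X)"
proof -
  obtain S i w S' \<sigma> where e: "m = (S, i, w)" "m' = (S', i, map \<sigma> w)" "finite S'"
    "strict_mono \<sigma>" "\<sigma> ` S \<subseteq> S'"
    using m(2) by (cases m; cases m') (auto simp: mono_le_def)
  have "((S' - \<sigma> ` S) \<union> \<sigma> ` S, i, map \<sigma> w) \<in> leads mono_order (preimage X)"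
    by (rule leads_wedge[OF X(1)]) (use leads_shift[OF X(2)] m(1) e in auto)
  then show ?thesis using e by (simp add: Un_absorb2)
qed

text \<open>The generators are the images of elements whose leads form a finite basis of all leads
  for \<open>mono_le\<close>. A stable \<open>Y\<close> containing them has the same leads as
  \<open>X\<close>, hence the same preimage. Intermediate \<open>Y\<close> appear because the R-span
  of a GL-stable space will be inserted for \<open>Y\<close>.\<close>

lemma finite_generators:
  assumes I: "finite I" and X: "X \<subseteq> M" "r_sub rmul X"
  shows "\<exists>G. finite G \<and> G \<subseteq> X \<and> (\<forall>Y. r_sub rmul Y \<longrightarrow> (\<forall>g\<in>GL. \<forall>x\<in>Y. act g x \<in> Y) \<longrightarrow>
    G \<subseteq> Y \<longrightarrow> Y \<subseteq> X \<longrightarrow> Y = X)"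
proof -
  let ?L = "\<lambda>X. leads mono_order (preimage X)"
  have L: "?L X \<subseteq> monomials dg I"
    using free_mod_supp by (auto simp: leads_def is_lead_def preimage_def)
  have "\<exists>L0. finite L0 \<and> L0 \<subseteq> ?L X \<and> (\<forall>m\<in>?L X. \<exists>m0\<in>L0. mono_le m0 m)"
  proof (rule finite_basis_of_good)
    fix f :: "nat \<Rightarrow> mono" assume "\<And>n. f n \<in> ?L X"
    then have "f n \<in> monomials dg I" for n using L by blast
    then show "\<exists>i j. i < j \<and> mono_le (f i) (f j)" by (rule mono_le_good[OF I])
  qed
  then obtain L0 where L0: "finite L0" "L0 \<subseteq> ?L X" "\<And>m. m \<in> ?L X \<Longrightarrow> \<exists>m0\<in>L0. mono_le m0 m"
    by blast
  have "\<forall>m\<in>L0. \<exists>F\<in>preimage X. is_lead mono_order F m" using L0(2) by (auto simp: leads_def)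
  then obtain f where f: "\<And>m. m \<in> L0 \<Longrightarrow> f m \<in> preimage X \<and> is_lead mono_order (f m) m" by metis
  let ?G = "(\<lambda>m. multiply (f m)) ` L0"
  have "Y = X" if Y: "r_sub rmul Y" "\<forall>g\<in>GL. \<forall>x\<in>Y. act g x \<in> Y" "?G \<subseteq> Y" "Y \<subseteq> X" for Y
  proof -
    have sub: "preimage Y \<subseteq> preimage X" using Y(4) by (auto simp: preimage_def)
    have "L0 \<subseteq> ?L Y"
    proof
      fix m assume "m \<in> L0"
      then have "f m \<in> preimage Y" "is_lead mono_order (f m) m"
        using f[of m] Y(3) by (auto simp: preimage_def)
      then show "m \<in> ?L Y" by (auto simp: leads_def)
    qed
    then have "?L X \<subseteq> ?L Y" using L0(3) leads_upward_closed[of Y] Y(1,2) by blast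
    then have "preimage Y = preimage X"
      by (intro subspace_eqI_leads[OF fun_subspace_preimage[OF Y(1)] fun_subspace_preimage[OF X(2)]
            sub _ _ mono_order(1,2) mono_order(3)[of dg I]])
        (auto simp: preimage_def free_modD(1) free_mod_supp)
    moreover have "multiply ` preimage Z = Z" if "Z \<subseteq> M" for Z
      using that multiply_surj unfolding preimage_def by blast
    ultimately show ?thesis using Y(4) X(1) by (metis order_trans)
  qed
  moreover have "?G \<subseteq> X" using f by (auto simp: preimage_def)
  ultimately show ?thesis using L0(1) by (intro exI[of _ ?G]) simp
qed

end

lemma presents_imp_poly_rep: "presents act rmul dg I N1 \<phi> U \<Longrightarrow> poly_rep act rmul U"
  unfolding poly_rep_iff presents_def tensor_sub_def by blast

lemma r_span_eq: "r_span rmul U = \<Inter>{N. U \<subseteq> N \<and> 0 \<in> N \<and> (\<forall>x\<in>N. \<forall>y\<in>N. x + y \<in> N) \<and>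
    (\<forall>r\<in>Rel. \<forall>x\<in>N. rmul r x \<in> N)}"
  by (simp add: r_span_def r_sub_def)

theorem theorem3p2:
  fixes act :: "(nat \<Rightarrow> nat \<Rightarrow> 'k::field) \<Rightarrow> 'm::ab_group_add \<Rightarrow> 'm"
    and rmul :: "(nat set \<Rightarrow> 'k) \<Rightarrow> 'm \<Rightarrow> 'm"
    and gr :: "int \<Rightarrow> 'm set"
    and M N :: "'m set"
  assumes "alg_closed_field TYPE('k)"
    and "prime CHAR('k)"
    and "is_Rmod act rmul gr M"
    and "fin_gen act rmul gr M"
    and "N \<subseteq> M"
    and "is_Rmod act rmul (\<lambda>n. gr n \<inter> N) N"
  shows "fin_gen act rmul (\<lambda>n. gr n \<inter> N) N"
proof -
  let ?gr = "\<lambda>n. gr n \<inter> N"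
  interpret N: gl_module act rmul ?gr N by unfold_locales (rule assms(6))
  obtain U0 where U0: "U0 \<subseteq> M" "gl_sub act rmul U0" "finite_length act rmul U0"
    "poly_rep act rmul U0" "M = r_span rmul U0"
    using assms(4) unfolding fin_gen_def r_span_eq[symmetric] by blast
  \<comment> \<open>Finite generation under GL is what permits a presentation of \<open>U0\<close>
    by finitely many tensor powers.\<close>
  obtain G0 where G0: "finite G0" "G0 \<subseteq> U0" "\<forall>W. gl_sub act rmul W \<longrightarrow> G0 \<subseteq> W \<longrightarrow> U0 \<subseteq> W"
    using finite_length_imp_finite_generators[OF U0(3)] by (elim exE conjE)
  obtain dg0 N0 \<phi>0 where p0: "presents act rmul dg0 UNIV N0 \<phi>0 U0"
    using U0(4) by (auto simp: poly_rep_iff)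
  obtain I N1 where I: "finite I" "presents act rmul dg0 I N1 \<phi>0 U0"
    using presents_finite_index[OF p0 U0(2) subset_refl G0] by (elim exE conjE)
  interpret M: presented_gl_module act rmul gr M dg0 I N1 \<phi>0 U0
    by unfold_locales (fact assms(3) I(2) U0(1) U0(5))+
  obtain G where G: "finite G" "G \<subseteq> N"
    "\<And>Y. r_sub rmul Y \<Longrightarrow> \<forall>g\<in>GL. \<forall>x\<in>Y. act g x \<in> Y \<Longrightarrow> G \<subseteq> Y \<Longrightarrow> Y \<subseteq> N \<Longrightarrow> Y = N"
    using M.finite_generators[OF I(1) assms(5) N.r_sub_carrier] by metis
  \<comment> \<open>\<open>fin_gen\<close> demands a graded generating space, so the generators are
    replaced by their homogeneous components, which lie in \<open>N\<close>.\<close>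
  have "\<forall>x\<in>G. \<exists>c. homog_decomp ?gr x c" using N.ex1_homog_decomp G(2) by blast
  then obtain c where c: "\<And>x. x \<in> G \<Longrightarrow> homog_decomp ?gr x (c x)" by metis
  define H where "H = (\<Union>x\<in>G. c x ` {n. c x n \<noteq> 0})"
  define U where "U = gl_span act rmul H"
  have "finite H" using G(1) c by (auto simp: H_def homog_decomp_def)
  have H_homog: "\<exists>n. y \<in> ?gr n" if "y \<in> H" for y
    using that c unfolding H_def homog_decomp_def by blast
  then have "H \<subseteq> N" by blast
  have U: "gl_sub act rmul U" "H \<subseteq> U" "\<forall>W. gl_sub act rmul W \<longrightarrow> H \<subseteq> W \<longrightarrow> U \<subseteq> W"
    unfolding U_def using gl_span(1)[of act rmul H] gl_span(2)[of H act rmul]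
    by (auto dest: gl_span(3)[of act rmul _ H])
  have "U \<subseteq> N" using U(3) N.gl_sub_carrier \<open>H \<subseteq> N\<close> by blast
  have graded: "\<forall>x\<in>U. \<forall>c. homog_decomp ?gr x c \<longrightarrow> (\<forall>n. c n \<in> U)"
    using N.gl_span_graded[OF H_homog] unfolding U_def by blast
  \<comment> \<open>\<open>U\<close> need not lie in \<open>U0\<close>, so its presentation is cut
    out of one for \<open>N\<close>.\<close>
  obtain dg' N' \<phi>' where p': "presents act rmul dg' UNIV N' \<phi>' N"
    using N.poly_rep by (auto simp: poly_rep_iff)
  obtain J N2 where J: "finite J" "presents act rmul dg' J N2 \<phi>' U"
    using presents_finite_index[OF p' U(1) \<open>U \<subseteq> N\<close> \<open>finite H\<close> U(2,3)] by (elim exE conjE)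
  have "r_span rmul U = N"
  proof (rule G(3))
    note RD = r_subD[OF r_span(1)[of rmul U]]
    show "r_sub rmul (r_span rmul U)" by (rule r_span(1))
    show "\<forall>g\<in>GL. \<forall>x\<in>r_span rmul U. act g x \<in> r_span rmul U"
      using N.act_r_span[OF \<open>U \<subseteq> N\<close> U(1)] by blast
    show "r_span rmul U \<subseteq> N" by (rule r_span(3)[OF N.r_sub_carrier \<open>U \<subseteq> N\<close>])
    have sum: "sum f A \<in> r_span rmul U" if "\<And>a. a \<in> A \<Longrightarrow> f a \<in> r_span rmul U" for f and A :: "int set"
      using that by (induction A rule: infinite_finite_induct) (auto intro: RD)
    show "G \<subseteq> r_span rmul U"
    proof
      fix x assume x: "x \<in> G"
      then have "x = sum (c x) {n. c x n \<noteq> 0}" using c by (simp add: homog_decomp_def)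
      moreover have "c x n \<in> r_span rmul U" if "c x n \<noteq> 0" for n
        using that x U(2) r_span(2)[of U rmul] by (auto simp: H_def)
      ultimately show "x \<in> r_span rmul U" using sum[of "{n. c x n \<noteq> 0}" "c x"] by simp
    qed
  qed
  then show ?thesis
    unfolding fin_gen_def r_span_eq[symmetric]
    using \<open>U \<subseteq> N\<close> U(1) graded presents_finite_length[OF assms(1) J(2,1)]
      presents_imp_poly_rep[OF J(2)] by blast
qed

end
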